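(* The vertex operator algebra $V=V_\Gamma^{\mathrm{orb}(\hat G)}$ of central charge $72$ with character $\chi_V(\tau)=q^{-3}+12q^{-1}+200+\mathcal{O}(q)$, namely the holomorphic $\mathbb Z_7\rtimes_2\mathbb Z_{78}$-orbifold of the lattice vertex operator algebra of the extremal lattice $\Gamma$ of rank $72$ described in the context, cannot be constructed as a cyclic orbifold of a lattice vertex operator algebra by a lifted lattice automorphism.
   Context: The character of a VOA $V$ of central charge $c$ is $\chi_V(\tau)=\mathrm{tr}_V\,q^{L_0-c/24}$, $q=e^{2\pi i\tau}$. $V_L$ denotes the lattice VOA of an even unimodular lattice $L$. A lift of $g\in\mathrm{Aut}(L)$ is an automorphism $\hat g$ of $V_L$ acting on the Heisenberg sub-VOA generated by $\mathfrak h=L\otimes_{\mathbb Z}\mathbb C$ through the linear extension of $g$, and on lattice states by $\hat g\,\mathfrak e_\alpha=\eta_g(\alpha)^{-1}\mathfrak e_{\alpha g}$ for a suitable function $\eta_g:L\to\mathbb C^*$; it is a standard lift if $\eta_g(\alpha)=1$ for all $\alpha\in L$ fixed by $g$. Orbifolds: for a finite solvable group $K$ of automorphisms of a holomorphic VOA $V_L$, the irreducible modules of the fixed-point VOA $V_L^K$ are governed by a class $[\omega]\in H^3(K,U(1))$. If $[\omega]$ is trivial, the orbifold $V_L^{\mathrm{orb}(K)}$ is the holomorphic extension of $V_L^K$ given as a $V_L^K$-module by $\bigoplus_k W_k^{C_k}$, where $k$ runs over representatives of the conjugacy classes of $K$, $W_k$ is the irreducible $k$-twisted $V_L$-module, $C_k$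 is the centralizer of $k$ in $K$, and $W_k^{C_k}$ is the $C_k$-invariant part. A cyclic orbifold by a lifted lattice automorphism is the case $K=\langle\hat g\rangle$ with $\hat g$ a lift, of finite order, of some $g\in\mathrm{Aut}(L)$. The specific VOA: $\Gamma$ is the known extremal even unimodular lattice of rank $72$. $G<\mathrm{Aut}(\Gamma)$ is a subgroup isomorphic to $\mathbb Z_7\rtimes_2\mathbb Z_{78}=\langle a,A: a^7=A^{78}=1,\ AaA^{-1}=a^2\rangle$, in which the generator of $\mathbb Z_7$ has cycle type $1^{-12}7^{12}$ and the generator of $\mathbb Z_{78}$ has cycle type $3^{2}6^{-2}39^{-2}78^{2}$ (cycle type $\prod_t t^{b_t}$ means characteristic polynomial $\prod_t(x^t-1)^{b_t}$ on $\Gamma$). $G$ is lifted by standard lifts to an isomorphic group $\hat G\cong G$ of automorphisms of $V_\Gamma$; for this group $[\omega]$ is trivial, and $V=V_\Gamma^{\mathrm{orb}(\hat G)}$ has the stated character. *)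

theory Defs
  imports
    "HOL-Analysis.Infinite_Sum"
    "HOL-Library.Landau_Symbols"
    "HOL-Library.Groups_Big_Fun"
    "HOL-Algebra.Solvable_Groups"
    "Jordan_Normal_Form.Char_Poly"
begin

section \<open>Linear algebra over the complex numbers\<close>

definition lin_on ::
  "(complex \<Rightarrow> 'v \<Rightarrow> 'v) \<Rightarrow> (complex \<Rightarrow> 'w \<Rightarrow> 'w) \<Rightarrow> 'v::ab_group_add set \<Rightarrow> ('v \<Rightarrow> 'w::ab_group_add) \<Rightarrow> bool"
  where "lin_on s s' S f \<longleftrightarrow>
    (\<forall>x\<in>S. \<forall>y\<in>S. f (x + y) = f x + f y) \<and> (\<forall>c. \<forall>x\<in>S. f (s c x) = s' c (f x))"

definition fin_dim :: "(complex \<Rightarrow> 'v \<Rightarrow> 'v) \<Rightarrow> 'v::ab_group_add set \<Rightarrow> bool"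
  where "fin_dim s S \<longleftrightarrow> (\<exists>B. finite B \<and> S \<subseteq> Modules.module.span s B)"

definition direct_sum ::
  "(complex \<Rightarrow> 'v \<Rightarrow> 'v) \<Rightarrow> 'i set \<Rightarrow> ('i \<Rightarrow> 'v::ab_group_add set) \<Rightarrow> 'v set \<Rightarrow> bool"
  where "direct_sum s I F S \<longleftrightarrow>
    (\<forall>i\<in>I. Modules.module.subspace s (F i)) \<and>
    Modules.module.span s (\<Union>i\<in>I. F i) = S \<and>
    (\<forall>J f. finite J \<and> J \<subseteq> I \<and> (\<forall>i\<in>J. f i \<in> F i) \<and> sum f J = 0 \<longrightarrow> (\<forall>i\<in>J. f i = 0))"


section \<open>Vertex operator algebras\<close>

text \<open>
  The underlying vector space is the whole type, with scalar multiplication \<open>scl\<close>.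
  \<open>vmode V a n b\<close> is \<open>a\<^sub>(\<^sub>n\<^sub>) b\<close>, where \<open>Y(a, z) b = (\<Sum>n. a\<^sub>(\<^sub>n\<^sub>) b z\<^bsup>-n-1\<^esup>)\<close>.
\<close>

record 'v voa_data =
  scl :: "complex \<Rightarrow> 'v \<Rightarrow> 'v"
  vmode :: "'v \<Rightarrow> int \<Rightarrow> 'v \<Rightarrow> 'v"
  vac :: 'v
  conf :: 'v
  central_charge :: complex

definition vir :: "'v voa_data \<Rightarrow> int \<Rightarrow> 'v \<Rightarrow> 'v"
  where "vir V n = vmode V (conf V) (n + 1)"

definition wt_space :: "'v voa_data \<Rightarrow> complex \<Rightarrow> 'v set"
  where "wt_space V r = {v. vir V 0 v = scl V r v}"

text \<open>
  The clause with \<open>gchoose\<close> is the Borcherds identity, equivalent to the Jacobi identity.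
  Its sums over \<open>i\<close> have only finitely many nonzero terms, by the truncation clause, so
  \<^const>\<open>Sum_any\<close> is the actual sum.
\<close>

definition voa :: "'v::ab_group_add voa_data \<Rightarrow> bool"
  where "voa V \<longleftrightarrow>
    vector_space (scl V) \<and>
    vac V \<noteq> 0 \<and>
    (\<forall>a n. lin_on (scl V) (scl V) UNIV (vmode V a n)) \<and>
    (\<forall>b n. lin_on (scl V) (scl V) UNIV (\<lambda>a. vmode V a n b)) \<and>
    (\<forall>a b. \<exists>N. \<forall>n\<ge>N. vmode V a n b = 0) \<and>
    (\<forall>n b. vmode V (vac V) n b = (if n = - 1 then b else 0)) \<and>
    (\<forall>a. vmode V a (- 1) (vac V) = a \<and> (\<forall>n\<ge>0. vmode V a n (vac V) = 0)) \<and>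
    (\<forall>a b c p q m.
      Sum_any (\<lambda>i::nat. scl V ((of_int p :: complex) gchoose i)
        (vmode V (vmode V a (m + int i) b) (p + q - int i) c)) =
      Sum_any (\<lambda>i::nat. scl V ((- 1) ^ i * ((of_int m :: complex) gchoose i))
        (vmode V a (p + m - int i) (vmode V b (q + int i) c)
         - scl V ((- 1) powi m) (vmode V b (q + m - int i) (vmode V a (p + int i) c))))) \<and>
    (\<forall>m n v. vir V m (vir V n v) - vir V n (vir V m v) =
      scl V (of_int (m - n)) (vir V (m + n) v)
      + scl V (if m + n = 0 then of_int (m ^ 3 - m) / 12 * central_charge V else 0) v) \<and>
    (\<forall>a n b. vmode V (vir V (- 1) a) n b = scl V (- of_int n) (vmode V a (n - 1) b)) \<and>
    direct_sum (scl V) UNIV (\<lambda>n::int. wt_space V (of_int n)) UNIV \<and>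
    (\<forall>n::int. fin_dim (scl V) (wt_space V (of_int n))) \<and>
    (\<exists>N::int. \<forall>n<N. wt_space V (of_int n) = {0})"

text \<open>
  The trace of \<open>q\<^bsup>L\<^sub>0 - c/24\<^esup>\<close>, as a function of \<open>\<tau>\<close>.
\<close>

definition qpar :: "complex \<Rightarrow> complex"
  where "qpar \<tau> = exp (2 * of_real pi * \<i> * \<tau>)"

definition voa_character :: "'v::ab_group_add voa_data \<Rightarrow> complex \<Rightarrow> complex"
  where "voa_character V \<tau> =
    infsum (\<lambda>n::int. of_nat (Vector_Spaces.vector_space.dim (scl V) (wt_space V (of_int n)))
      * exp (2 * of_real pi * \<i> * \<tau> * (of_int n - central_charge V / 24))) UNIV"

definition voa_aut :: "'v::ab_group_add voa_data \<Rightarrow> ('v \<Rightarrow> 'v) \<Rightarrow> bool"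
  where "voa_aut V f \<longleftrightarrow>
    lin_on (scl V) (scl V) UNIV f \<and> bij f \<and>
    (\<forall>a n b. f (vmode V a n b) = vmode V (f a) n (f b)) \<and>
    f (vac V) = vac V \<and> f (conf V) = conf V"

definition voa_aut_group :: "'v::ab_group_add voa_data \<Rightarrow> ('v \<Rightarrow> 'v) monoid"
  where "voa_aut_group V = \<lparr>carrier = {f. voa_aut V f}, mult = (\<circ>), one = id\<rparr>"

definition fixed_points :: "('v \<Rightarrow> 'v) set \<Rightarrow> 'v set"
  where "fixed_points K = {v. \<forall>k\<in>K. k v = v}"


section \<open>(Twisted) modules\<close>

text \<open>
  The space of a module is a subspace \<open>mcar M\<close> of the fixed space \<^typ>\<open>complex poly\<close>, which has
  countably infinite dimension.  A VOA has countable dimension, and therefore so has every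
  module generated by finitely many vectors; in particular every irreducible (twisted) module has
  an isomorphic copy of this form.  For complete reducibility of admissible modules it also
  suffices to consider modules of countable dimension, since every admissible module is the sum of
  those submodules that are generated by one homogeneous vector.

  \<open>mact M a p w\<close> is \<open>a\<^sub>(\<^sub>p\<^sub>) w\<close>; it is only relevant for \<open>w \<in> mcar M\<close>.
\<close>

record 'v vmodule =
  mcar :: "complex poly set"
  mact :: "'v \<Rightarrow> rat \<Rightarrow> complex poly \<Rightarrow> complex poly"

text \<open>
  \<open>g\<close> is an automorphism of finite order.  The modes of a vector \<open>a\<close> with \<open>g a = e\<^bsup>2\<pi>ir\<^esup> a\<close>
  have index in \<open>r + \<int>\<close>.  With the opposite sign convention \<open>g\<close>-twisted modules become
  \<open>g\<^sup>-\<^sup>1\<close>-twisted; orbifolds, which involve all classes of a group, do not change.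
  For \<open>g = id\<close> these are the weak (untwisted) modules.
\<close>

definition weak_twisted_module ::
  "'v::ab_group_add voa_data \<Rightarrow> ('v \<Rightarrow> 'v) \<Rightarrow> 'v vmodule \<Rightarrow> bool"
  where "weak_twisted_module V g M \<longleftrightarrow>
    Modules.module.subspace Polynomial.smult (mcar M) \<and>
    (\<forall>a p. \<forall>w\<in>mcar M. mact M a p w \<in> mcar M) \<and>
    (\<forall>a p. lin_on Polynomial.smult Polynomial.smult (mcar M) (mact M a p)) \<and>
    (\<forall>p. \<forall>w\<in>mcar M. lin_on (scl V) Polynomial.smult UNIV (\<lambda>a. mact M a p w)) \<and>
    (\<forall>a. \<forall>w\<in>mcar M. \<exists>N. \<forall>p\<ge>N. mact M a p w = 0) \<and>
    (\<forall>a r p. \<forall>w\<in>mcar M. g a = scl V (cis (2 * pi * of_rat r)) a \<and> p - r \<notin> \<int>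
      \<longrightarrow> mact M a p w = 0) \<and>
    (\<forall>p. \<forall>w\<in>mcar M. mact M (vac V) p w = (if p = - 1 then w else 0)) \<and>
    (\<forall>a b r s p q. \<forall>m::int. \<forall>w\<in>mcar M.
      g a = scl V (cis (2 * pi * of_rat r)) a \<and> g b = scl V (cis (2 * pi * of_rat s)) b \<and>
      p - r \<in> \<int> \<and> q - s \<in> \<int> \<longrightarrow>
      Sum_any (\<lambda>i::nat. Polynomial.smult ((of_rat p :: complex) gchoose i)
        (mact M (vmode V a (m + int i) b) (p + q - of_nat i) w)) =
      Sum_any (\<lambda>i::nat. Polynomial.smult ((- 1) ^ i * ((of_int m :: complex) gchoose i))
        (mact M a (p + of_int m - of_nat i) (mact M b (q + of_nat i) w)
         - Polynomial.smult ((- 1) powi m)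
             (mact M b (q + of_int m - of_nat i) (mact M a (p + of_nat i) w)))))"

definition simple_module :: "'v vmodule \<Rightarrow> bool"
  where "simple_module M \<longleftrightarrow> mcar M \<noteq> {0} \<and>
    (\<forall>N. Modules.module.subspace Polynomial.smult N \<and> N \<subseteq> mcar M \<and>
      (\<forall>a p. \<forall>w\<in>N. mact M a p w \<in> N) \<longrightarrow> N = {0} \<or> N = mcar M)"

definition mod_wt_space :: "'v voa_data \<Rightarrow> 'v vmodule \<Rightarrow> complex \<Rightarrow> complex poly set"
  where "mod_wt_space V M r = {w \<in> mcar M. mact M (conf V) 1 w = Polynomial.smult r w}"

definition irreducible_twisted_module ::
  "'v::ab_group_add voa_data \<Rightarrow> ('v \<Rightarrow> 'v) \<Rightarrow> 'v vmodule \<Rightarrow> bool"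
  where "irreducible_twisted_module V g M \<longleftrightarrow>
    weak_twisted_module V g M \<and> simple_module M \<and>
    direct_sum Polynomial.smult UNIV (mod_wt_space V M) (mcar M) \<and>
    (\<forall>r. fin_dim Polynomial.smult (mod_wt_space V M r)) \<and>
    (\<forall>r. \<exists>N::rat. \<forall>x<N. mod_wt_space V M (r + of_rat x) = {0})"

definition admissible_module :: "'v::ab_group_add voa_data \<Rightarrow> 'v vmodule \<Rightarrow> bool"
  where "admissible_module V M \<longleftrightarrow>
    weak_twisted_module V id M \<and>
    (\<exists>Gr :: nat \<Rightarrow> complex poly set. direct_sum Polynomial.smult UNIV Gr (mcar M) \<and>
      (\<forall>k m :: int. \<forall>a \<in> wt_space V (of_int k). \<forall>l. \<forall>w\<in>Gr l.
        (let d = int l + k - m - 1 in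
          if d < 0 then mact M a (of_int m) w = 0 else mact M a (of_int m) w \<in> Gr (nat d))))"

definition rational_voa :: "'v::ab_group_add voa_data \<Rightarrow> bool"
  where "rational_voa V \<longleftrightarrow> (\<forall>M. admissible_module V M \<longrightarrow>
    (\<exists>\<N>. direct_sum Polynomial.smult \<N> (\<lambda>N. N) (mcar M) \<and>
      (\<forall>N\<in>\<N>. admissible_module V (M\<lparr>mcar := N\<rparr>) \<and> simple_module (M\<lparr>mcar := N\<rparr>))))"

definition C2_cofinite :: "'v::ab_group_add voa_data \<Rightarrow> bool"
  where "C2_cofinite V \<longleftrightarrow>
    (\<exists>B. finite B \<and> Modules.module.span (scl V) (B \<union> {vmode V a (- 2) b | a b. True}) = UNIV)"

definition CFT_type :: "'v::ab_group_add voa_data \<Rightarrow> bool"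
  where "CFT_type V \<longleftrightarrow> (\<forall>n::int. n < 0 \<longrightarrow> wt_space V (of_int n) = {0}) \<and>
    wt_space V 0 = Modules.module.span (scl V) {vac V}"

definition simple_voa :: "'v::ab_group_add voa_data \<Rightarrow> bool"
  where "simple_voa V \<longleftrightarrow> (\<forall>I. Modules.module.subspace (scl V) I \<and>
    (\<forall>a n. \<forall>v\<in>I. vmode V a n v \<in> I) \<longrightarrow> I = {0} \<or> I = UNIV)"

text \<open>
  Self-contragredience need not be required: the contragredient of \<open>V\<close> is an irreducible module,
  hence isomorphic to \<open>V\<close>.
\<close>

definition holomorphic_voa :: "'v::ab_group_add voa_data \<Rightarrow> bool"
  where "holomorphic_voa V \<longleftrightarrow>
    voa V \<and> CFT_type V \<and> rational_voa V \<and> C2_cofinite V \<and> simple_voa V \<and>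
    (\<forall>M. irreducible_twisted_module V id M \<longrightarrow>
      (\<exists>f. lin_on (scl V) Polynomial.smult UNIV f \<and> bij_betw f UNIV (mcar M) \<and>
        (\<forall>a (n::int) b. f (vmode V a n b) = mact M a (of_int n) (f b))))"


section \<open>Orbifolds\<close>

definition conj_class_reps :: "('v \<Rightarrow> 'v) set \<Rightarrow> ('v \<Rightarrow> 'v) set \<Rightarrow> bool"
  where "conj_class_reps K R \<longleftrightarrow> R \<subseteq> K \<and>
    (\<forall>k\<in>K. \<exists>!r. r \<in> R \<and> (\<exists>x\<in>K. x \<circ> k = r \<circ> x))"

definition centralizer :: "('v \<Rightarrow> 'v) set \<Rightarrow> ('v \<Rightarrow> 'v) \<Rightarrow> ('v \<Rightarrow> 'v) set"
  where "centralizer K k = {x \<in> K. x \<circ> k = k \<circ> x}"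

text \<open>
  The defining property of the action of \<open>C\<close> on a twisted module \<open>W\<close>:
  \<open>\<phi>(c) Y(a, z) \<phi>(c)\<^sup>-\<^sup>1 = Y(c a, z)\<close>.
\<close>

definition acts_on_module ::
  "('v \<Rightarrow> 'v) set \<Rightarrow> (('v \<Rightarrow> 'v) \<Rightarrow> complex poly \<Rightarrow> complex poly) \<Rightarrow> 'v vmodule \<Rightarrow> bool"
  where "acts_on_module C \<phi> W \<longleftrightarrow>
    (\<forall>c\<in>C. lin_on Polynomial.smult Polynomial.smult (mcar W) (\<phi> c) \<and> bij_betw (\<phi> c) (mcar W) (mcar W)) \<and>
    (\<forall>c\<in>C. \<forall>d\<in>C. \<forall>w\<in>mcar W. \<phi> (c \<circ> d) w = \<phi> c (\<phi> d w)) \<and>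
    (\<forall>c\<in>C. \<forall>a p. \<forall>w\<in>mcar W. \<phi> c (mact W a p w) = mact W (c a) p (\<phi> c w))"

definition invariants ::
  "('v \<Rightarrow> 'v) set \<Rightarrow> (('v \<Rightarrow> 'v) \<Rightarrow> complex poly \<Rightarrow> complex poly) \<Rightarrow> 'v vmodule \<Rightarrow> complex poly set"
  where "invariants C \<phi> W = {w \<in> mcar W. \<forall>c\<in>C. \<phi> c w = w}"

text \<open>
  \<open>V\<close> is the orbifold \<open>V\<^sub>0\<^bsup>orb(K)\<^esup>\<close>, up to isomorphism: \<open>V\<close> is holomorphic, \<open>\<iota>\<close> embeds the
  fixed-point VOA \<open>V\<^sub>0\<^bsup>K\<^esup>\<close> into \<open>V\<close> with the same vacuum and conformal vector, and as a
  \<open>V\<^sub>0\<^bsup>K\<^esup>\<close>-module \<open>V\<close> is the direct sum of the \<open>W\<^sub>k\<^bsup>C\<^sub>k\<^esup>\<close>, via the maps \<open>j k\<close>.  For \<open>k = id\<close>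
  the twisted module is \<open>V\<^sub>0\<close> itself with the action of \<open>C\<^sub>i\<^sub>d = K\<close>, so that its summand is
  \<open>V\<^sub>0\<^bsup>K\<^esup>\<close>, embedded by \<open>\<iota>\<close>.  On vectors of \<open>V\<^sub>0\<^bsup>K\<^esup>\<close> the modes on \<open>W\<^sub>k\<close> have integral index.
\<close>

definition is_orbifold ::
  "'u::ab_group_add voa_data \<Rightarrow> ('u \<Rightarrow> 'u) set \<Rightarrow> 'v::ab_group_add voa_data \<Rightarrow> bool"
  where "is_orbifold V0 K V \<longleftrightarrow>
    voa V0 \<and> finite K \<and> subgroup K (voa_aut_group V0) \<and>
    solvable (voa_aut_group V0\<lparr>carrier := K\<rparr>) \<and>
    holomorphic_voa V \<and>
    (\<exists>R W \<phi> j \<iota>.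
      conj_class_reps K R \<and>
      (\<forall>k\<in>R - {id}. irreducible_twisted_module V0 k (W k) \<and>
        acts_on_module (centralizer K k) (\<phi> k) (W k)) \<and>
      lin_on (scl V0) (scl V) (fixed_points K) \<iota> \<and> inj_on \<iota> (fixed_points K) \<and>
      \<iota> (vac V0) = vac V \<and> \<iota> (conf V0) = conf V \<and>
      (\<forall>a\<in>fixed_points K. \<forall>b\<in>fixed_points K. \<forall>n.
        \<iota> (vmode V0 a n b) = vmode V (\<iota> a) n (\<iota> b)) \<and>
      (\<forall>k\<in>R - {id}. let M = invariants (centralizer K k) (\<phi> k) (W k) in
        lin_on Polynomial.smult (scl V) M (j k) \<and> inj_on (j k) M \<and>
        (\<forall>a\<in>fixed_points K. \<forall>n::int. \<forall>w\<in>M.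
          j k (mact (W k) a (of_int n) w) = vmode V (\<iota> a) n (j k w))) \<and>
      direct_sum (scl V) R
        (\<lambda>k. if k = id then \<iota> ` fixed_points K
              else j k ` invariants (centralizer K k) (\<phi> k) (W k)) UNIV)"


section \<open>Even unimodular lattices\<close>

text \<open>
  A lattice of rank \<open>n\<close> is \<open>\<int>\<^sup>n = carrier_vec n\<close> with the bilinear form of a Gram matrix \<open>Q\<close>.
  The form is also used on \<open>\<complex>\<^sup>n = L \<otimes> \<complex>\<close>.
\<close>

definition lat_form :: "int mat \<Rightarrow> 'a::comm_ring_1 vec \<Rightarrow> 'a vec \<Rightarrow> 'a"
  where "lat_form Q x y = x \<bullet> (map_mat of_int Q *\<^sub>v y)"

definition even_unimodular :: "nat \<Rightarrow> int mat \<Rightarrow> bool"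
  where "even_unimodular n Q \<longleftrightarrow>
    Q \<in> carrier_mat n n \<and> transpose_mat Q = Q \<and>
    (\<forall>x::int vec \<in> carrier_vec n. x \<noteq> 0\<^sub>v n \<longrightarrow> lat_form Q x x > 0) \<and>
    (\<forall>x::int vec \<in> carrier_vec n. even (lat_form Q x x)) \<and>
    det Q = 1"

definition extremal :: "nat \<Rightarrow> int mat \<Rightarrow> bool"
  where "extremal n Q \<longleftrightarrow>
    (\<forall>x::int vec \<in> carrier_vec n. x \<noteq> 0\<^sub>v n \<longrightarrow> lat_form Q x x \<ge> 2 * int (n div 24) + 2) \<and>
    (\<exists>x::int vec \<in> carrier_vec n. lat_form Q x x = 2 * int (n div 24) + 2)"

definition lat_aut :: "nat \<Rightarrow> int mat \<Rightarrow> int mat \<Rightarrow> bool"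
  where "lat_aut n Q g \<longleftrightarrow> g \<in> carrier_mat n n \<and> transpose_mat g * Q * g = Q"

definition lat_aut_group :: "nat \<Rightarrow> int mat \<Rightarrow> int mat monoid"
  where "lat_aut_group n Q = \<lparr>carrier = {g. lat_aut n Q g}, mult = (*), one = 1\<^sub>m n\<rparr>"

text \<open>
  \<open>has_cycle_type g bs\<close>: the characteristic polynomial of \<open>g\<close> is the product of the
  \<open>(x\<^sup>t - 1)\<^sup>b\<close> for \<open>(t, b)\<close> in \<open>bs\<close>, with the factors with negative \<open>b\<close> moved to the other side.
\<close>

definition has_cycle_type :: "int mat \<Rightarrow> (nat \<times> int) list \<Rightarrow> bool"
  where "has_cycle_type g bs \<longleftrightarrow>
    char_poly g * (\<Prod>(t, b)\<leftarrow>bs. (monom 1 t - 1) ^ nat (- b))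
      = (\<Prod>(t, b)\<leftarrow>bs. (monom 1 t - 1) ^ nat b)"

text \<open>The Leech lattice is the unique even unimodular lattice of rank 24 without roots.\<close>

definition leech_lattice :: "int mat \<Rightarrow> bool"
  where "leech_lattice Q \<longleftrightarrow> even_unimodular 24 Q \<and>
    (\<forall>x::int vec \<in> carrier_vec 24. lat_form Q x x \<noteq> 2)"

text \<open>
  The known extremal lattice of rank 72 (Nebe).  Let \<open>\<Lambda>\<close> be the Leech lattice with a Hermitian
  structure over \<open>\<int>[\<alpha>]\<close>, \<open>\<alpha> = (1 + \<surd>-7)/2\<close>: multiplication by \<open>\<alpha>\<close> satisfies \<open>\<alpha>\<^sup>2 - \<alpha> + 2 = 0\<close>,
  and its adjoint is \<open>\<beta> = 1 - \<alpha>\<close>.  The lattice is the Hermitian tensor product of \<open>\<Lambda>\<close> with the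
  Barnes lattice, which is spanned by \<open>(\<beta>,\<beta>,0)\<close>, \<open>(0,\<beta>,\<beta>)\<close>, \<open>(\<alpha>,\<alpha>,\<alpha>)\<close> in \<open>\<int>[\<alpha>]\<^sup>3\<close>
  and has the form \<open>(\<Sum>i. x\<^sub>i \<cdot> cnj y\<^sub>i)/2\<close>.  So it consists of the
  \<open>(\<alpha>m + \<beta>a, \<alpha>m + \<beta>b, \<alpha>m + \<beta>c) \<in> \<Lambda>\<^sup>3\<close> with \<open>a + b + c \<in> \<alpha>\<Lambda>\<close>, with half the form of \<open>\<Lambda>\<^sup>3\<close>;
  \<open>F\<^sub>1, F\<^sub>2, F\<^sub>3\<close> are the components of an isometry onto it.  \<open>\<Lambda>\<close> has nine such structures,
  exactly one of which leads to an extremal lattice.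
\<close>

definition nebe_lattice :: "int mat \<Rightarrow> bool"
  where "nebe_lattice Q \<longleftrightarrow>
    even_unimodular 72 Q \<and> extremal 72 Q \<and>
    (\<exists>\<Lambda> \<alpha> \<beta> F1 F2 F3 :: int mat.
      leech_lattice \<Lambda> \<and>
      \<alpha> \<in> carrier_mat 24 24 \<and> \<beta> = 1\<^sub>m 24 - \<alpha> \<and>
      \<alpha> * \<alpha> - \<alpha> + 2 \<cdot>\<^sub>m 1\<^sub>m 24 = 0\<^sub>m 24 24 \<and>
      (\<forall>x \<in> carrier_vec 24. \<forall>y \<in> carrier_vec 24.
        lat_form \<Lambda> (\<alpha> *\<^sub>v x) y = lat_form \<Lambda> x (\<beta> *\<^sub>v y)) \<and>
      F1 \<in> carrier_mat 24 72 \<and> F2 \<in> carrier_mat 24 72 \<and> F3 \<in> carrier_mat 24 72 \<and>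
      (\<lambda>v. (F1 *\<^sub>v v, F2 *\<^sub>v v, F3 *\<^sub>v v)) ` carrier_vec 72 =
        {(\<alpha> *\<^sub>v m + \<beta> *\<^sub>v a, \<alpha> *\<^sub>v m + \<beta> *\<^sub>v b, \<alpha> *\<^sub>v m + \<beta> *\<^sub>v c) | m a b c.
          m \<in> carrier_vec 24 \<and> a \<in> carrier_vec 24 \<and> b \<in> carrier_vec 24 \<and> c \<in> carrier_vec 24 \<and>
          a + b + c \<in> (*\<^sub>v) \<alpha> ` carrier_vec 24} \<and>
      (\<forall>v \<in> carrier_vec 72. \<forall>w \<in> carrier_vec 72.
        2 * lat_form Q v w = lat_form \<Lambda> (F1 *\<^sub>v v) (F1 *\<^sub>v w)
          + lat_form \<Lambda> (F2 *\<^sub>v v) (F2 *\<^sub>v w) + lat_form \<Lambda> (F3 *\<^sub>v v) (F3 *\<^sub>v w)))"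

text \<open>
  The group \<open>\<langle>a, A : a\<^sup>7 = A\<^bsup>78\<^esup> = 1, A a A\<^sup>-\<^sup>1 = a\<^sup>2\<rangle>\<close>, with \<open>(i, j)\<close> standing for \<open>a\<^sup>i A\<^sup>j\<close>.
\<close>

definition Z7_Z78 :: "(nat \<times> nat) monoid"
  where "Z7_Z78 = \<lparr>carrier = {..<7} \<times> {..<78},
    mult = (\<lambda>(i, j) (k, l). ((i + 2 ^ j * k) mod 7, (j + l) mod 78)), one = (0, 0)\<rparr>"


section \<open>Lattice vertex operator algebras\<close>

text \<open>
  If the \<open>D m\<close> commute, \<open>exp_coeff s D j\<close> is the coefficient of \<open>z\<^sup>j\<close> in
  \<open>exp (\<Sum>m>0. D m z\<^sup>m / m)\<close>.  (Apply \<open>z d/dz\<close>.)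
\<close>

fun exp_coeff :: "(complex \<Rightarrow> 'v \<Rightarrow> 'v) \<Rightarrow> (nat \<Rightarrow> 'v \<Rightarrow> 'v) \<Rightarrow> nat \<Rightarrow> 'v::ab_group_add \<Rightarrow> 'v"
  where "exp_coeff s D j v =
    (if j = 0 then v else s (1 / of_nat j) (\<Sum>m = 1..j. D m (exp_coeff s D (j - m) v)))"

declare exp_coeff.simps [simp del]

definition fock_space ::
  "nat \<Rightarrow> 'v::ab_group_add voa_data \<Rightarrow> (complex vec \<Rightarrow> 'v) \<Rightarrow> 'v \<Rightarrow> 'v set"
  where "fock_space n V h v = Modules.module.span (scl V)
    {foldr (\<lambda>(x, m). vmode V (h x) (- int m)) xs v | xs.
      \<forall>(x, m) \<in> set xs. x \<in> carrier_vec n \<and> m > 0}"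

text \<open>
  A 2-cocycle defining the twisted group algebra; another choice gives an isomorphic VOA.
\<close>

definition lattice_cocycle :: "nat \<Rightarrow> int mat \<Rightarrow> (int vec \<Rightarrow> int vec \<Rightarrow> complex) \<Rightarrow> bool"
  where "lattice_cocycle n Q \<epsilon> \<longleftrightarrow>
    (\<forall>a \<in> carrier_vec n. \<forall>b \<in> carrier_vec n.
      \<epsilon> a b \<in> {1, - 1} \<and> \<epsilon> a b * \<epsilon> b a = (- 1) powi (lat_form Q a b) \<and>
      (\<forall>c \<in> carrier_vec n. \<epsilon> a b * \<epsilon> (a + b) c = \<epsilon> b c * \<epsilon> a (b + c))) \<and>
    (\<forall>a \<in> carrier_vec n. \<epsilon> a (0\<^sub>v n) = 1 \<and> \<epsilon> (0\<^sub>v n) a = 1)"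

text \<open>
  \<open>V\<close> is the lattice VOA \<open>V\<^sub>L = S(t\<^sup>-\<^sup>1\<hh>[t\<^sup>-\<^sup>1]) \<otimes> \<complex>\<^sub>\<epsilon>[L]\<close>, where \<open>h x\<close> is the state \<open>x(-1)1\<close> for
  \<open>x \<in> \<hh> = L \<otimes> \<complex>\<close>, and \<open>e \<alpha>\<close> the state \<open>1 \<otimes> \<ee>\<^sub>\<alpha>\<close>.  A level one Heisenberg module generated by a
  nonzero highest weight vector is a Fock space \<open>S(t\<^sup>-\<^sup>1\<hh>[t\<^sup>-\<^sup>1])\<close>, so that \<open>e \<alpha> \<noteq> 0\<close> and the direct
  sum decomposition describe the space of states.  The operators \<open>T \<alpha>\<close> are the multiplications
  by \<open>\<ee>\<^sub>\<alpha>\<close> on the second tensor factor, and the clause after them is, on the summand of \<open>\<beta>\<close>,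
  \<open>Y(\<ee>\<^sub>\<alpha>, z) = exp (\<Sum>m>0. \<alpha>\<^sub>(\<^sub>-\<^sub>m\<^sub>) z\<^sup>m / m) exp (- \<Sum>m>0. \<alpha>\<^sub>(\<^sub>m\<^sub>) z\<^bsup>-m\<^esup> / m) \<ee>\<^sub>\<alpha> z\<^bsup>(\<alpha>,\<beta>)\<^esup>\<close>.
  In the conformal vector, \<open>P\<close> is the inverse Gram matrix.
\<close>

definition lattice_voa ::
  "nat \<Rightarrow> int mat \<Rightarrow> (int vec \<Rightarrow> int vec \<Rightarrow> complex) \<Rightarrow> 'v::ab_group_add voa_data \<Rightarrow>
    (complex vec \<Rightarrow> 'v) \<Rightarrow> (int vec \<Rightarrow> 'v) \<Rightarrow> bool"
  where "lattice_voa n Q \<epsilon> V h e \<longleftrightarrow>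
    even_unimodular n Q \<and> lattice_cocycle n Q \<epsilon> \<and> voa V \<and> central_charge V = of_nat n \<and>
    (\<forall>x \<in> carrier_vec n. \<forall>y \<in> carrier_vec n. h (x + y) = h x + h y) \<and>
    (\<forall>c. \<forall>x \<in> carrier_vec n. h (c \<cdot>\<^sub>v x) = scl V c (h x)) \<and>
    (\<forall>x \<in> carrier_vec n. \<forall>y \<in> carrier_vec n. \<forall>m k v.
      vmode V (h x) m (vmode V (h y) k v) - vmode V (h y) k (vmode V (h x) m v) =
        (if m + k = 0 then scl V (of_int m * lat_form Q x y) v else 0)) \<and>
    e (0\<^sub>v n) = vac V \<and>
    (\<forall>\<alpha> \<in> carrier_vec n. e \<alpha> \<noteq> 0 \<and>
      (\<forall>x \<in> carrier_vec n. \<forall>m\<ge>0. vmode V (h x) m (e \<alpha>) =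
        (if m = 0 then scl V (lat_form Q x (map_vec of_int \<alpha>)) (e \<alpha>) else 0))) \<and>
    direct_sum (scl V) (carrier_vec n) (\<lambda>\<alpha>. fock_space n V h (e \<alpha>)) UNIV \<and>
    (\<exists>T. \<forall>\<alpha> \<in> carrier_vec n.
      lin_on (scl V) (scl V) UNIV (T \<alpha>) \<and>
      (\<forall>\<beta> \<in> carrier_vec n. T \<alpha> (e \<beta>) = scl V (\<epsilon> \<alpha> \<beta>) (e (\<alpha> + \<beta>))) \<and>
      (\<forall>x \<in> carrier_vec n. \<forall>m v. m \<noteq> 0 \<longrightarrow>
        T \<alpha> (vmode V (h x) m v) = vmode V (h x) m (T \<alpha> v)) \<and>
      (\<forall>\<beta> \<in> carrier_vec n. \<forall>v \<in> fock_space n V h (e \<beta>). \<forall>k.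
        vmode V (e \<alpha>) k v =
          Sum_any (\<lambda>(i::nat, j::nat).
            if int i - int j + lat_form Q \<alpha> \<beta> = - k - 1
            then exp_coeff (scl V) (\<lambda>m. vmode V (h (map_vec of_int \<alpha>)) (- int m)) i
              (exp_coeff (scl V) (\<lambda>m w. - vmode V (h (map_vec of_int \<alpha>)) (int m) w) j (T \<alpha> v))
            else 0))) \<and>
    (\<exists>P \<in> carrier_mat n n. Q * P = 1\<^sub>m n \<and>
      conf V = scl V (1 / 2) (\<Sum>i<n. \<Sum>j<n. scl V (of_int (P $$ (i, j)))
        (vmode V (h (unit_vec n i)) (- 1) (h (unit_vec n j)))))"

text \<open>
  Lattice automorphisms act on column vectors from the left; \<open>g \<alpha>\<close> is written \<open>\<alpha>g\<close> for a right
  action.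
\<close>

definition lift_with ::
  "nat \<Rightarrow> 'v::ab_group_add voa_data \<Rightarrow> (complex vec \<Rightarrow> 'v) \<Rightarrow> (int vec \<Rightarrow> 'v) \<Rightarrow>
    int mat \<Rightarrow> (int vec \<Rightarrow> complex) \<Rightarrow> ('v \<Rightarrow> 'v) \<Rightarrow> bool"
  where "lift_with n V h e g \<eta> f \<longleftrightarrow> voa_aut V f \<and>
    (\<forall>x \<in> carrier_vec n. f (h x) = h (map_mat of_int g *\<^sub>v x)) \<and>
    (\<forall>\<alpha> \<in> carrier_vec n. \<eta> \<alpha> \<noteq> 0 \<and> f (e \<alpha>) = scl V (inverse (\<eta> \<alpha>)) (e (g *\<^sub>v \<alpha>)))"

definition is_lift ::
  "nat \<Rightarrow> 'v::ab_group_add voa_data \<Rightarrow> (complex vec \<Rightarrow> 'v) \<Rightarrow> (int vec \<Rightarrow> 'v) \<Rightarrow>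
    int mat \<Rightarrow> ('v \<Rightarrow> 'v) \<Rightarrow> bool"
  where "is_lift n V h e g f \<longleftrightarrow> (\<exists>\<eta>. lift_with n V h e g \<eta> f)"

definition is_standard_lift ::
  "nat \<Rightarrow> 'v::ab_group_add voa_data \<Rightarrow> (complex vec \<Rightarrow> 'v) \<Rightarrow> (int vec \<Rightarrow> 'v) \<Rightarrow>
    int mat \<Rightarrow> ('v \<Rightarrow> 'v) \<Rightarrow> bool"
  where "is_standard_lift n V h e g f \<longleftrightarrow> (\<exists>\<eta>. lift_with n V h e g \<eta> f \<and>
    (\<forall>\<alpha> \<in> carrier_vec n. g *\<^sub>v \<alpha> = \<alpha> \<longrightarrow> \<eta> \<alpha> = 1))"

end

theory Submission
  imports Defs "Jordan_Normal_Form.Jordan_Normal_Form_Existence"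
begin

text \<open>
  The fixed points of a lift of \<open>g\<close> contain \<open>S\<^sup>2(\<hh>)\<^sup>g\<close> in weight two, and this space has
  dimension at least \<open>n/2\<close> for every isometry \<open>g\<close> of finite order: in an eigenbasis \<open>v\<^sub>i\<close> with
  eigenvalues \<open>l\<^sub>i\<close>, the Gram matrix is invertible, so by the Leibniz formula there is a
  permutation \<open>p\<close> with \<open>(v\<^sub>i, v\<^bsub>p(i)\<^esub>) \<noteq> 0\<close> for all \<open>i\<close>.  Invariance of the form gives
  \<open>l\<^sub>i l\<^bsub>p(i)\<^esub> = 1\<close>, hence the monomials \<open>v\<^sub>i v\<^bsub>p(i)\<^esub>\<close> are invariant, and at least \<open>n/2\<close> of them are
  distinct.  The central charge forces \<open>n = 72\<close>, so a cyclic orbifold of a lattice vertex operator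
  algebra has at least \<open>36\<close> dimensions in weight two, while the character allows only \<open>12\<close>.
\<close>

section \<open>Eigenbases of isometries of finite order\<close>

lemma four_block_diag_eq_oneD:
  assumes A: "A \<in> carrier_mat a a" and B: "B \<in> carrier_mat b b"
    and eq: "four_block_mat A (0\<^sub>m a b) (0\<^sub>m b a) B = 1\<^sub>m (a + b)"
  shows "A = 1\<^sub>m a" "B = 1\<^sub>m b"
proof -
  have "four_block_mat A (0\<^sub>m a b) (0\<^sub>m b a) B $$ (i, j) = 1\<^sub>m (a + b) $$ (i, j)" for i j
    by (simp only: eq)
  note entry = this
  show "A = 1\<^sub>m a"
  proof (rule eq_matI)
    fix i j assume "i < dim_row (1\<^sub>m a)" "j < dim_col (1\<^sub>m a)"
    then show "A $$ (i, j) = 1\<^sub>m a $$ (i, j)" using entry[of i j] A B by auto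
  qed (use A in auto)
  show "B = 1\<^sub>m b"
  proof (rule eq_matI)
    fix i j assume "i < dim_row (1\<^sub>m b)" "j < dim_col (1\<^sub>m b)"
    then show "B $$ (i, j) = 1\<^sub>m b $$ (i, j)" using entry[of "a + i" "a + j"] A B by auto
  qed (use B in auto)
qed

text \<open>In the \<open>m\<close>-th power the diagonal entry is \<open>a ^ m\<close> and the
  entry to its right is \<open>m * a ^ (m - 1)\<close>. The first being 1 makes \<open>a\<close>
  nonzero, and then characteristic zero keeps the second from vanishing.\<close>

lemma jordan_block_pow_eq_one:
  fixes a :: "'a::field_char_0"
  assumes "jordan_block n a ^\<^sub>m m = 1\<^sub>m n" "m > 0"
  shows "n \<le> 1"
proof (rule ccontr)
  assume "\<not> n \<le> 1"
  then have n: "0 < n" "1 < n" by auto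
  have "(jordan_block n a ^\<^sub>m m) $$ (0, 0) = 1" "(jordan_block n a ^\<^sub>m m) $$ (0, 1) = 0"
    using assms n by auto
  then have "a ^ m = 1" "of_nat m * a ^ (m - 1) = 0"
    using n by (auto simp: jordan_block_pow)
  then show False using \<open>m > 0\<close> by (auto simp: power_0_left)
qed

lemma jordan_matrix_pow_eq_one:
  fixes n_as :: "(nat \<times> 'a::field_char_0) list"
  assumes "jordan_matrix n_as ^\<^sub>m m = 1\<^sub>m (sum_list (map fst n_as))" "m > 0" "(n, a) \<in> set n_as"
  shows "n \<le> 1"
  using assms
proof (induction n_as)
  case (Cons x xs)
  obtain k b where x: "x = (k, b)" by (cases x)
  let ?B = "diag_block_mat (map (\<lambda>(n, a). jordan_block n a ^\<^sub>m m) xs)"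
  let ?s = "sum_list (map fst xs)"
  have B: "?B = jordan_matrix xs ^\<^sub>m m" by (simp add: jordan_matrix_pow)
  have Bc: "?B \<in> carrier_mat ?s ?s" unfolding B by (rule pow_carrier_mat) simp
  have dims: "dim_row ?B = ?s" "dim_col ?B = ?s" using Bc by auto
  have "four_block_mat (jordan_block k b ^\<^sub>m m) (0\<^sub>m k ?s) (0\<^sub>m ?s k) ?B = 1\<^sub>m (k + ?s)"
    using Cons.prems(1) \<open>m > 0\<close> unfolding jordan_matrix_pow x by (simp add: Let_def dims)
  from four_block_diag_eq_oneD[OF _ Bc this]
  have "jordan_block k b ^\<^sub>m m = 1\<^sub>m k" "jordan_matrix xs ^\<^sub>m m = 1\<^sub>m ?s"
    unfolding B by auto
  then show ?case
    using Cons jordan_block_pow_eq_one x by auto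
qed simp

lemma jordan_matrix_size_one_offdiag:
  assumes "\<And>n a. (n, a) \<in> set n_as \<Longrightarrow> n \<le> 1"
    and "i < sum_list (map fst n_as)" "j < sum_list (map fst n_as)" "i \<noteq> j"
  shows "jordan_matrix n_as $$ (i, j) = 0"
  using assms
proof (induction n_as arbitrary: i j)
  case (Cons x xs)
  obtain k b where x: "x = (k, b)" by (cases x)
  have k: "k \<le> 1" using Cons.prems(1) x by force
  \<comment> \<open>With a first block of size at most one, two distinct indices either straddle it,
    where the entry is zero, or both lie beyond it; subtracting \<open>k\<close> moves them to the
    remaining blocks.\<close>
  have IH: "jordan_matrix xs $$ (i - k, j - k) = 0"
    if "i - k < sum_list (map fst xs)" "j - k < sum_list (map fst xs)" "i - k \<noteq> j - k"
    using Cons.IH[OF _ that] Cons.prems(1) by (meson list.set_intros(2))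
  show ?case
    using Cons.prems(2-) IH k
    unfolding x jordan_matrix_Cons by auto
qed simp

text \<open>Over the complex numbers \<open>g\<close> has a Jordan form. Its \<open>m\<close>-th
  power is conjugate to the identity, hence equal to it, so no block exceeds size one and the form
  is diagonal.\<close>

lemma finite_order_imp_diagonalizable:
  fixes g :: "complex mat"
  assumes g: "g \<in> carrier_mat n n" and pow: "g ^\<^sub>m m = 1\<^sub>m n" and m: "m > 0"
  obtains S R l where "S \<in> carrier_mat n n" "R \<in> carrier_mat n n" "S * R = 1\<^sub>m n" "R * S = 1\<^sub>m n"
    "g * S = S * mat_diag n l"
proof -
  obtain n_as where "jordan_nf g n_as"
    using char_poly_factorized[OF g] jordan_nf_exists[OF g] by blast
  then have sim: "similar_mat g (jordan_matrix n_as)" by (simp add: jordan_nf_def)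
  let ?J = "jordan_matrix n_as"
  obtain S R where w: "similar_mat_wit g ?J S R" using sim by (auto simp: similar_mat_def)
  note wD = similar_mat_witD[OF _ w]
  have dim: "n = dim_row g" using g by auto
  have SR: "S * R = 1\<^sub>m n" "R * S = 1\<^sub>m n" and gS: "g = S * ?J * R"
    and S: "S \<in> carrier_mat n n" and R: "R \<in> carrier_mat n n" and J: "?J \<in> carrier_mat n n"
    using wD[OF dim] by auto
  have s: "sum_list (map fst n_as) = n"
    using carrier_matD(1)[OF J] by (simp only: jordan_matrix_dim)
  have "similar_mat_wit (1\<^sub>m n) (?J ^\<^sub>m m) S R"
    using similar_mat_wit_pow[OF w, of m] pow by simp
  then have "similar_mat_wit (?J ^\<^sub>m m) (1\<^sub>m n) R S" by (rule similar_mat_wit_sym)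
  then have "?J ^\<^sub>m m = R * 1\<^sub>m n * S"
    by (meson similar_mat_witD(3))
  then have J1: "?J ^\<^sub>m m = 1\<^sub>m n" using right_mult_one_mat[OF R] SR(2) by (simp only:)
  have small: "k \<le> 1" if "(k, a) \<in> set n_as" for k a
    using jordan_matrix_pow_eq_one[of n_as m k a] J1 m that unfolding s by blast
  have "?J = mat_diag n (\<lambda>i. ?J $$ (i, i))"
  proof (rule eq_matI)
    fix i j assume "i < dim_row (mat_diag n (\<lambda>i. ?J $$ (i, i)))"
      "j < dim_col (mat_diag n (\<lambda>i. ?J $$ (i, i)))"
    then have "i < n" "j < n" by (auto simp: mat_diag_def)
    then show "?J $$ (i, j) = mat_diag n (\<lambda>i. ?J $$ (i, i)) $$ (i, j)"
      using jordan_matrix_size_one_offdiag[of n_as i j] small unfolding s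
      by (cases "i = j") (auto simp: mat_diag_def)
  qed (use s in \<open>simp_all add: mat_diag_def\<close>)
  moreover have "g * S = S * ?J"
  proof -
    have "S * ?J * R * S = S * ?J * (R * S)" using S R J by (intro assoc_mult_mat[of _ n n _ n _ n]) auto
    also have "\<dots> = S * ?J" unfolding SR(2) using S J by (intro right_mult_one_mat[of _ n n]) auto
    finally show ?thesis unfolding gS .
  qed
  ultimately show ?thesis using that S R SR by metis
qed

section \<open>The pairing of eigenvectors under an invariant form\<close>

lemma det_nonzero_obtain_perm:
  fixes B :: "'a::idom mat"
  assumes B: "B \<in> carrier_mat n n" and "det B \<noteq> 0"
  obtains p where "p permutes {0..<n}" "\<And>i. i < n \<Longrightarrow> B $$ (i, p i) \<noteq> 0"
proof -
  have "(\<Sum>p | p permutes {0..<n}. signof p * (\<Prod>i = 0..<n. B $$ (i, p i))) \<noteq> 0"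
    using assms by (simp add: det_def')
  then obtain p where "p permutes {0..<n}" "(\<Prod>i = 0..<n. B $$ (i, p i)) \<noteq> 0"
    by (metis (no_types, lifting) mem_Collect_eq mult_zero_right sum.neutral)
  then show ?thesis using that by auto
qed

lemma mult_mat_regroup_ends:
  fixes A B C D E :: "'a::semiring_1 mat"
  assumes "A \<in> carrier_mat n n" "B \<in> carrier_mat n n" "C \<in> carrier_mat n n"
    "D \<in> carrier_mat n n" "E \<in> carrier_mat n n"
  shows "A * (B * (C * D)) * E = (A * B) * (C * (D * E))"
  using assms by (simp add: assoc_mult_mat[of _ n n _ n _ n])

lemma mult_mat_regroup_middle:
  fixes A B C D E :: "'a::semiring_1 mat"
  assumes "A \<in> carrier_mat n n" "B \<in> carrier_mat n n" "C \<in> carrier_mat n n"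
    "D \<in> carrier_mat n n" "E \<in> carrier_mat n n"
  shows "(A * B) * (C * (D * E)) = A * ((B * C * D) * E)"
  using assms by (simp add: assoc_mult_mat[of _ n n _ n _ n])

text \<open>The \<open>v i\<close> are the columns of a diagonalising matrix; the \<open>w i\<close>
  are dual to them under \<open>Q\<close> and serve later to read off coefficients. The index
  \<open>p i\<close> belongs to an eigenvector not orthogonal to \<open>v i\<close>, so invariance
  of the form makes the two eigenvalues reciprocal.\<close>

lemma isometry_eigenbasis:
  fixes g Q P :: "complex mat"
  assumes g: "g \<in> carrier_mat n n" and Q: "Q \<in> carrier_mat n n" and P: "P \<in> carrier_mat n n"
    and QP: "Q * P = 1\<^sub>m n" and iso: "transpose_mat g * Q * g = Q"
    and pow: "g ^\<^sub>m m = 1\<^sub>m n" and m: "m > 0"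
  obtains v w :: "nat \<Rightarrow> complex vec" and l :: "nat \<Rightarrow> complex" and p
  where "\<And>i. i < n \<Longrightarrow> v i \<in> carrier_vec n" "\<And>i. i < n \<Longrightarrow> w i \<in> carrier_vec n"
    "\<And>i. i < n \<Longrightarrow> g *\<^sub>v v i = l i \<cdot>\<^sub>v v i"
    "\<And>i j. i < n \<Longrightarrow> j < n \<Longrightarrow> w i \<bullet> (Q *\<^sub>v v j) = (if i = j then 1 else 0)"
    "\<And>i. i < n \<Longrightarrow> p i < n" "\<And>i. i < n \<Longrightarrow> l i * l (p i) = 1"
proof -
  obtain S R l where S: "S \<in> carrier_mat n n" and R: "R \<in> carrier_mat n n"
    and SR: "S * R = 1\<^sub>m n" and RS: "R * S = 1\<^sub>m n" and gS: "g * S = S * mat_diag n l"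
    using finite_order_imp_diagonalizable[OF g pow m] by metis
  let ?D = "mat_diag n l" and ?St = "transpose_mat S" and ?gt = "transpose_mat g"
  let ?B = "?St * (Q * S)"
  have D: "?D \<in> carrier_mat n n" and St: "?St \<in> carrier_mat n n" and gt: "?gt \<in> carrier_mat n n"
    and B: "?B \<in> carrier_mat n n"
    using S g Q by auto
  note as = assoc_mult_mat[of _ n n _ n _ n]
  have PQ: "P * Q = 1\<^sub>m n" using mat_mult_left_right_inverse[OF Q P QP] .
  \<comment> \<open>Since \<open>R\<close> inverts \<open>S\<close> and \<open>P\<close> inverts
    \<open>Q\<close>, the rows of \<open>R * P\<close> form the basis dual to the columns of
    \<open>S\<close>.\<close>
  have W: "(R * P) * (Q * S) = 1\<^sub>m n"
  proof -
    have "(R * P) * (Q * S) = R * ((P * Q) * S)"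
      using R P Q S by (simp add: as)
    then show ?thesis using PQ S RS by simp
  qed
  have "det ?B \<noteq> 0"
  proof -
    have "det S \<noteq> 0" "det Q \<noteq> 0"
      using det_mult[OF S R] det_mult[OF Q P] SR QP by auto
    then show ?thesis using S Q St by (simp add: det_mult[of _ n] det_transpose[of _ n])
  qed
  then obtain p where p: "p permutes {0..<n}" "\<And>i. i < n \<Longrightarrow> ?B $$ (i, p i) \<noteq> 0"
    using det_nonzero_obtain_perm[OF B] by metis
  have Dt: "transpose_mat ?D = ?D" by (rule eq_matI) (auto simp: mat_diag_def)
  have "transpose_mat (g * S) = ?D * ?St"
    unfolding gS using S D by (simp add: transpose_mult[of _ n n _ n] Dt)
  then have DSt: "?D * ?St = ?St * ?gt" using g S by (simp add: transpose_mult[of _ n n _ n])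
  \<comment> \<open>The Gram matrix of the images of the eigenvectors under \<open>g\<close> is
    evaluated twice: pulling out the eigenvalues gives \<open>?D * ?B * ?D\<close>, and invariance
    of \<open>Q\<close> gives \<open>?B\<close>.\<close>
  have "?D * ?B * ?D = (?D * ?St) * (Q * (S * ?D))"
    by (rule mult_mat_regroup_ends[OF D St Q S D])
  moreover have "(?St * ?gt) * (Q * (g * S)) = ?St * ((?gt * Q * g) * S)"
    by (rule mult_mat_regroup_middle[OF St gt Q g S])
  ultimately have DBD: "?D * ?B * ?D = ?B"
    unfolding DSt gS[symmetric] iso by simp
  have ent: "l i * l j * ?B $$ (i, j) = ?B $$ (i, j)" if "i < n" "j < n" for i j
  proof -
    have "(?D * ?B * ?D) $$ (i, j) = l i * l j * ?B $$ (i, j)"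
      using that B D by (simp add: mat_diag_mult_left[OF B] mat_diag_mult_right[of _ n n])
    then show ?thesis using DBD by simp
  qed
  show ?thesis
  proof (rule that[of "\<lambda>i. col S i" "\<lambda>i. row (R * P) i" l p])
    show "col S i \<in> carrier_vec n" "row (R * P) i \<in> carrier_vec n" if "i < n" for i
      using S R P that by auto
    show "g *\<^sub>v col S i = l i \<cdot>\<^sub>v col S i" if i: "i < n" for i
    proof -
      have "g *\<^sub>v col S i = col (g * S) i" using col_mult2[OF g S i] by simp
      also have "\<dots> = l i \<cdot>\<^sub>v col S i"
        unfolding gS mat_diag_mult_right[OF S] using S i by (intro eq_vecI) auto
      finally show ?thesis .
    qed
    show "row (R * P) i \<bullet> (Q *\<^sub>v col S j) = (if i = j then 1 else 0)" if "i < n" "j < n" for i j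
    proof -
      have "row (R * P) i \<bullet> (Q *\<^sub>v col S j) = ((R * P) * (Q * S)) $$ (i, j)"
        unfolding col_mult2[OF Q S that(2), symmetric]
        using that R P Q S by (intro index_mult_mat(1)[symmetric]) auto
      then show ?thesis unfolding W using that by simp
    qed
    show "p i < n" if "i < n" for i using p(1) that by (metis atLeastLessThan_iff permutes_in_image zero_le)
    then show "l i * l (p i) = 1" if "i < n" for i
      using ent[of i "p i"] p(2)[OF that] that by simp
  qed
qed

section \<open>Heisenberg vertex operators in weight two\<close>

text \<open>Independence is stated through coefficients of the indexed family, so that it includes
  injectivity of \<open>u\<close> on \<open>T\<close>. The finite spanning set guards against the
  value 0 that \<open>dim\<close> takes, through \<open>card\<close>, on spaces with an infinite
  basis.\<close>

lemma (in vector_space) card_le_dimI: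
  assumes T: "finite T" and indep: "\<And>c. (\<Sum>t\<in>T. scale (c t) (u t)) = 0 \<Longrightarrow> \<forall>t\<in>T. c t = 0"
    and sub: "u ` T \<subseteq> S" and B: "finite B" "S \<subseteq> span B"
  shows "card T \<le> dim S"
proof -
  have inj: "inj_on u T"
  proof (rule inj_onI, rule ccontr)
    fix s t assume st: "s \<in> T" "t \<in> T" "u s = u t" "s \<noteq> t"
    \<comment> \<open>A repeated vector would give the nontrivial relation
      \<open>u s - u t = 0\<close>.\<close>
    define c where "c r = (if r = s then 1 else if r = t then - 1 else 0 :: 'a)" for r
    have "(\<Sum>r\<in>T. scale (c r) (u r)) = (\<Sum>r\<in>{s, t}. scale (c r) (u r))"
      by (rule sum.mono_neutral_right) (use T st in \<open>auto simp: c_def\<close>)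
    also have "\<dots> = 0" using st by (simp add: c_def)
    finally show False using indep[of c] st by (auto simp: c_def)
  qed
  have ind: "independent (u ` T)"
  proof
    assume "dependent (u ` T)"
    then obtain d where d: "\<exists>v\<in>u ` T. d v \<noteq> 0" "(\<Sum>v\<in>u ` T. scale (d v) v) = 0"
      using T by (auto simp: dependent_finite)
    have "(\<Sum>t\<in>T. scale (d (u t)) (u t)) = 0"
      using d(2) inj by (simp add: sum.reindex)
    then show False using indep[of "\<lambda>t. d (u t)"] d(1) by auto
  qed
  obtain B' where B': "B' \<subseteq> S" "independent B'" "S \<subseteq> span B'" "card B' = dim S"
    using basis_exists by metis
  have "finite B'" using independent_span_bound[OF B(1) B'(2)] B B'(1) by blast
  then have "card (u ` T) \<le> card B'"
    using independent_span_bound[OF _ ind] sub B'(3) by blast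
  then show ?thesis using B'(4) card_image[OF inj] by simp
qed


section \<open>Consequences of the vertex algebra axioms\<close>

locale vertex_operator_algebra =
  fixes V :: "'v::ab_group_add voa_data"
  assumes voa: "voa V"
begin

sublocale vector_space "scl V"
  using voa by (simp add: voa_def)

lemma mode_add: "vmode V a k (x + y) = vmode V a k x + vmode V a k y"
  and mode_scale: "vmode V a k (scl V c x) = scl V c (vmode V a k x)"
  and mode_add_left: "vmode V (x + y) k b = vmode V x k b + vmode V y k b"
  and mode_scale_left: "vmode V (scl V c x) k b = scl V c (vmode V x k b)"
  using voa by (simp_all add: voa_def lin_on_def)

lemma mode_zero [simp]: "vmode V a k 0 = 0"
  and mode_zero_left [simp]: "vmode V 0 k b = 0"
  using mode_scale[of a k 0 0] mode_scale_left[of 0 0 k b] by simp_all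

lemma mode_sum: "vmode V a k (sum u I) = (\<Sum>i\<in>I. vmode V a k (u i))"
  and mode_sum_left: "vmode V (sum u I) k b = (\<Sum>i\<in>I. vmode V (u i) k b)"
  by (induction I rule: infinite_finite_induct) (simp_all add: mode_add mode_add_left)

lemma vac_nonzero: "vac V \<noteq> 0"
  and creation: "vmode V a (- 1) (vac V) = a"
  and mode_nonneg_vac: "k \<ge> 0 \<Longrightarrow> vmode V a k (vac V) = 0"
  using voa unfolding voa_def by blast+

lemma borcherds:
  "Sum_any (\<lambda>i::nat. scl V ((of_int p :: complex) gchoose i)
      (vmode V (vmode V a (m + int i) b) (p + q - int i) c)) =
    Sum_any (\<lambda>i::nat. scl V ((- 1) ^ i * ((of_int m :: complex) gchoose i))
      (vmode V a (p + m - int i) (vmode V b (q + int i) c)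
       - scl V ((- 1) powi m) (vmode V b (q + m - int i) (vmode V a (p + int i) c))))"
  using voa by (simp add: voa_def)

lemma virasoro:
  "vir V m (vir V k v) - vir V k (vir V m v) =
    scl V (of_int (m - k)) (vir V (m + k) v)
    + scl V (if m + k = 0 then of_int (m ^ 3 - m) / 12 * central_charge V else 0) v"
  using voa by (simp add: voa_def)

lemma translation: "vmode V (vir V (- 1) a) k b = scl V (- of_int k) (vmode V a (k - 1) b)"
  using voa by (simp add: voa_def)

lemma fin_dim_wt_space: "fin_dim (scl V) (wt_space V (of_int k))"
  using voa by (simp add: voa_def)

lemma vac_in_wt_space: "vac V \<in> wt_space V 0"
  by (simp add: wt_space_def vir_def mode_nonneg_vac)

lemma one_le_dim_wt_space_0: "dim (wt_space V (of_int 0)) \<ge> 1"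
proof -
  obtain B where B: "finite B" "wt_space V (of_int 0) \<subseteq> span B"
    using fin_dim_wt_space[of 0] unfolding fin_dim_def by blast
  have "card {vac V} \<le> dim (wt_space V (of_int 0))"
    by (rule card_le_dimI[where u = "\<lambda>x. x", OF _ _ _ B]) (use vac_nonzero vac_in_wt_space in auto)
  then show ?thesis by simp
qed

text \<open>This is the bracket of the Virasoro modes 2 and -2 on the vacuum, with central term (8 -
  2)/12 = 1/2. It lets an embedding that preserves vacuum and conformal vector determine the central
  charge.\<close>

lemma conf_mode_3_conf: "vmode V (conf V) 3 (conf V) = scl V (central_charge V / 2) (vac V)"
  using virasoro[of 2 "- 2" "vac V"] by (simp add: vir_def mode_nonneg_vac creation)

text \<open>Borcherds identity for \<open>conf V\<close> and \<open>b\<close> with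
  \<open>p = 1\<close>, \<open>m = 0\<close>, \<open>q = k\<close>. The binomials leave the terms 0
  and 1 on the left and the term 0 on the right; translation covariance turns the left term 0 into
  the shift by \<open>k + 1\<close>.\<close>

lemma L0_commutator:
  "vir V 0 (vmode V b k c) =
    vmode V b k (vir V 0 c) + vmode V (vir V 0 b) k c - scl V (of_int (k + 1)) (vmode V b k c)"
proof -
  let ?L = "\<lambda>i::nat. scl V ((of_int 1 :: complex) gchoose i)
      (vmode V (vmode V (conf V) (0 + int i) b) (1 + k - int i) c)"
  let ?R = "\<lambda>i::nat. scl V ((- 1) ^ i * ((of_int 0 :: complex) gchoose i))
      (vmode V (conf V) (1 + 0 - int i) (vmode V b (k + int i) c)
       - scl V ((- 1) powi 0) (vmode V b (k + 0 - int i) (vmode V (conf V) (1 + int i) c)))"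
  have "i = 0 \<or> i = 1" if "(1 :: complex) gchoose i \<noteq> 0" for i
    using that binomial_gbinomial[of 1 i, where 'a = complex, symmetric] binomial_eq_0[of 1 i]
    by (cases "1 < i") auto
  then have "Sum_any ?L = sum ?L {0, 1}"
    by (intro Sum_any.expand_superset) auto
  also have "\<dots> = vmode V (vir V (- 1) b) (k + 1) c + vmode V (vir V 0 b) k c"
    by (simp add: vir_def add.commute)
  finally have L: "Sum_any ?L = vmode V (vir V 0 b) k c - scl V (of_int (k + 1)) (vmode V b k c)"
    by (simp only: translation add_diff_cancel_right' scale_minus_left uminus_add_conv_diff)
  have "(0 :: complex) gchoose i = 0" if "i \<ge> 1" for i
    using that binomial_gbinomial[of 0 i, where 'a = complex] binomial_eq_0[of 0 i] by simp
  then have "Sum_any ?R = sum ?R {0}"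
    by (intro Sum_any.expand_superset) (auto simp: Suc_le_eq)
  also have "\<dots> = vir V 0 (vmode V b k c) - vmode V b k (vir V 0 c)"
    by (simp add: vir_def)
  finally have R: "Sum_any ?R = vir V 0 (vmode V b k c) - vmode V b k (vir V 0 c)" .
  have "Sum_any ?L = Sum_any ?R" by (rule borcherds)
  then have "vir V 0 (vmode V b k c) - vmode V b k (vir V 0 c) =
      vmode V (vir V 0 b) k c - scl V (of_int (k + 1)) (vmode V b k c)"
    unfolding L R by (rule sym)
  then have "vir V 0 (vmode V b k c) =
      (vmode V (vir V 0 b) k c - scl V (of_int (k + 1)) (vmode V b k c)) + vmode V b k (vir V 0 c)"
    by (simp only: diff_eq_eq)
  then show ?thesis by (simp only: add_diff_eq add.commute)
qed

text \<open>Borcherds identity with \<open>p = 0\<close>, \<open>m = - 1\<close>,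
  \<open>q = 1\<close>: the left side collapses to one term, all signed binomials on the right are
  1, and \<open>(- 1) powi (- 1)\<close> turns the difference into a sum.\<close>

lemma normal_product_mode:
  "vmode V (vmode V a (- 1) b) 1 c =
    Sum_any (\<lambda>i::nat. vmode V a (- 1 - int i) (vmode V b (1 + int i) c)
      + vmode V b (- int i) (vmode V a (int i) c))"
proof -
  let ?L = "\<lambda>i::nat. scl V ((of_int 0 :: complex) gchoose i)
      (vmode V (vmode V a (- 1 + int i) b) (0 + 1 - int i) c)"
  have "(0 :: complex) gchoose i = 0" if "i \<ge> 1" for i
    using that binomial_gbinomial[of 0 i, where 'a = complex] binomial_eq_0[of 0 i] by simp
  then have "Sum_any ?L = sum ?L {0}"
    by (intro Sum_any.expand_superset) (auto simp: Suc_le_eq)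
  then have L: "Sum_any ?L = vmode V (vmode V a (- 1) b) 1 c" by simp
  have "(- 1) ^ i * ((- 1 :: complex) gchoose i) = 1" for i
    by (simp add: gbinomial_minus binomial_gbinomial[symmetric] flip: power_mult_distrib)
  then show ?thesis
    using L borcherds[of 0 a "- 1" b 1 c] by simp
qed

end

text \<open>Isolates the Heisenberg fields of a lattice VOA together with the Sugawara form of the
  conformal vector, the data from which weights of quadratic states are computed.\<close>

locale heisenberg_voa = vertex_operator_algebra V
  for V :: "'v::ab_group_add voa_data" +
  fixes n :: nat and Q P :: "int mat" and h :: "complex vec \<Rightarrow> 'v"
  assumes Q: "Q \<in> carrier_mat n n" and Q_sym: "transpose_mat Q = Q"
    and P: "P \<in> carrier_mat n n" and QP: "Q * P = 1\<^sub>m n"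
    and h_add: "\<And>x y. x \<in> carrier_vec n \<Longrightarrow> y \<in> carrier_vec n \<Longrightarrow> h (x + y) = h x + h y"
    and h_scale: "\<And>c x. x \<in> carrier_vec n \<Longrightarrow> h (c \<cdot>\<^sub>v x) = scl V c (h x)"
    and heis_comm: "\<And>x y m k v. x \<in> carrier_vec n \<Longrightarrow> y \<in> carrier_vec n \<Longrightarrow>
      vmode V (h x) m (vmode V (h y) k v) - vmode V (h y) k (vmode V (h x) m v) =
        (if m + k = 0 then scl V (of_int m * lat_form Q x y) v else 0)"
    and conf_eq: "conf V = scl V (1 / 2) (\<Sum>i<n. \<Sum>j<n. scl V (of_int (P $$ (i, j)))
        (vmode V (h (unit_vec n i)) (- 1) (h (unit_vec n j))))"
begin

abbreviation Qc :: "complex mat" where "Qc \<equiv> map_mat of_int Q"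
abbreviation Pc :: "complex mat" where "Pc \<equiv> map_mat of_int P"

lemma Qc: "Qc \<in> carrier_mat n n" and Pc: "Pc \<in> carrier_mat n n"
  using Q P by auto

lemma QcPc: "Qc * Pc = 1\<^sub>m n"
proof -
  have "map_mat of_int (Q * P) = Qc * Pc" by (rule of_int_hom.mat_hom_mult[OF Q P])
  then show ?thesis unfolding QP of_int_hom.mat_hom_one by simp
qed

lemma PcQc: "Pc * Qc = 1\<^sub>m n"
  using mat_mult_left_right_inverse[OF Qc Pc QcPc] .

lemma PctQc: "transpose_mat Pc * Qc = 1\<^sub>m n"
proof -
  have "transpose_mat Qc = Qc" using Q_sym by (metis map_mat_transpose)
  then have "transpose_mat Pc * Qc = transpose_mat (Qc * Pc)"
    using transpose_mult[OF Qc Pc] by simp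
  then show ?thesis by (simp add: QcPc)
qed

lemma h_zero: "h (0\<^sub>v n) = 0"
proof -
  have "0 \<cdot>\<^sub>v 0\<^sub>v n = (0\<^sub>v n :: complex vec)" by auto
  then show ?thesis using h_scale[of "0\<^sub>v n" 0] by simp
qed

text \<open>Write \<open>h y\<close> as its mode -1 on the vacuum and commute: nonnegative modes
  kill the vacuum, so only the central term survives, at \<open>k = 1\<close>.\<close>

lemma heis_mode_heis:
  assumes "x \<in> carrier_vec n" "y \<in> carrier_vec n" "k \<ge> 0"
  shows "vmode V (h x) k (h y) = (if k = 1 then scl V (lat_form Q x y) (vac V) else 0)"
  using heis_comm[OF assms(1,2), of k "- 1" "vac V"] assms(3)
  by (simp add: creation mode_nonneg_vac)

lemma h_coords:
  assumes "x \<in> carrier_vec n"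
  shows "h x = (\<Sum>i<n. scl V (x $ i) (h (unit_vec n i)))"
proof -
  \<comment> \<open>As \<open>h\<close> is linear on \<open>carrier_vec n\<close> only, the
    induction keeps the length and fills in one coordinate at a time, padding with zeros.\<close>
  have "h (vec n (\<lambda>i. if i < k then x $ i else 0)) = (\<Sum>i<k. scl V (x $ i) (h (unit_vec n i)))"
    if "k \<le> n" for k
    using that
  proof (induction k)
    case 0
    have "vec n (\<lambda>i. if i < 0 then x $ i else 0) = 0\<^sub>v n" by auto
    then show ?case by (simp add: h_zero)
  next
    case (Suc k)
    have "vec n (\<lambda>i. if i < Suc k then x $ i else 0) =
      vec n (\<lambda>i. if i < k then x $ i else 0) + x $ k \<cdot>\<^sub>v unit_vec n k"
      using Suc.prems by (intro eq_vecI) (auto simp: unit_vec_def less_Suc_eq)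
    then show ?case using Suc by (simp add: h_add h_scale)
  qed
  from this[of n] have "h (vec n (\<lambda>i. if i < n then x $ i else 0)) =
      (\<Sum>i<n. scl V (x $ i) (h (unit_vec n i)))" by simp
  moreover have "vec n (\<lambda>i. if i < n then x $ i else 0) = x" using assms by (intro eq_vecI) auto
  ultimately show ?thesis by simp
qed

lemma normal_product_heis:
  assumes "x \<in> carrier_vec n" "y \<in> carrier_vec n" "z \<in> carrier_vec n"
  shows "vmode V (vmode V (h x) (- 1) (h y)) 1 (h z) =
    scl V (lat_form Q y z) (h x) + scl V (lat_form Q x z) (h y)"
proof -
  let ?f = "\<lambda>i::nat. vmode V (h x) (- 1 - int i) (vmode V (h y) (1 + int i) (h z))
      + vmode V (h y) (- int i) (vmode V (h x) (int i) (h z))"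
  \<comment> \<open>The term 0 contributes through its first summand and the term 1 through its
    second; all other modes vanish on \<open>h z\<close>.\<close>
  have "Sum_any ?f = sum ?f {0, 1}"
    by (rule Sum_any.expand_superset) (use assms in \<open>auto simp: heis_mode_heis\<close>)
  then show ?thesis
    using assms by (simp add: normal_product_mode heis_mode_heis mode_scale creation)
qed

lemma L0_heis:
  assumes x: "x \<in> carrier_vec n"
  shows "vir V 0 (h x) = h x"
proof -
  let ?e = "unit_vec n"
  \<comment> \<open>The entries of \<open>y\<close> are the pairings of \<open>x\<close> with the
    unit vectors. The two halves of the Sugawara sum then become \<open>Pc *\<^sub>v y\<close> and
    its transposed version, both equal to \<open>x\<close>, which cancels the factor 1/2.\<close>
  define y where "y = Qc *\<^sub>v x"
  have y: "y \<in> carrier_vec n" using Qc x by (simp add: y_def)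
  have form: "lat_form Q (?e i) x = y $ i" if "i < n" for i
    using that y by (simp add: lat_form_def y_def[symmetric])
  have "Pc *\<^sub>v y = x"
    unfolding y_def using Pc Qc x by (simp add: assoc_mult_mat_vec[of _ n n _ n, symmetric] PcQc)
  then have Py: "(\<Sum>j<n. of_int (P $$ (i, j)) * y $ j) = x $ i" if "i < n" for i
    using that P y by (auto simp: scalar_prod_def lessThan_atLeast0 dest!: arg_cong[of _ _ "\<lambda>v. v $ i"])
  have "transpose_mat Pc *\<^sub>v y = x"
    unfolding y_def using Pc Qc x by (simp add: assoc_mult_mat_vec[of _ n n _ n, symmetric] PctQc)
  then have Pty: "(\<Sum>i<n. of_int (P $$ (i, j)) * y $ i) = x $ j" if "j < n" for j
    using that P y by (auto simp: scalar_prod_def lessThan_atLeast0 dest!: arg_cong[of _ _ "\<lambda>v. v $ j"])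
  have "vir V 0 (h x) = scl V (1 / 2) (\<Sum>i<n. \<Sum>j<n. scl V (of_int (P $$ (i, j)))
      (scl V (y $ j) (h (?e i)) + scl V (y $ i) (h (?e j))))"
    unfolding vir_def conf_eq
    by (simp add: mode_sum_left mode_scale_left normal_product_heis x form)
  also have "(\<Sum>i<n. \<Sum>j<n. scl V (of_int (P $$ (i, j)))
      (scl V (y $ j) (h (?e i)) + scl V (y $ i) (h (?e j)))) =
    (\<Sum>i<n. scl V (\<Sum>j<n. of_int (P $$ (i, j)) * y $ j) (h (?e i))) +
    (\<Sum>j<n. scl V (\<Sum>i<n. of_int (P $$ (i, j)) * y $ i) (h (?e j)))"
    using sum.swap[of "\<lambda>i j. scl V (of_int (P $$ (i, j)) * y $ i) (h (?e j))" "{..<n}" "{..<n}"]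
    by (simp add: scale_right_distrib sum.distrib scale_sum_left)
  also have "\<dots> = h x + h x" by (simp add: Py Pty h_coords[OF x])
  also have "\<dots> = scl V 2 (h x)" using scale_left_distrib[of 1 1 "h x"] by simp
  finally show ?thesis by simp
qed

text \<open>At mode -1 the shift in \<open>L0_commutator\<close> vanishes, so the weights 1 and 1
  add.\<close>

lemma quadratic_weight_two:
  assumes "x \<in> carrier_vec n" "y \<in> carrier_vec n"
  shows "vmode V (h x) (- 1) (h y) \<in> wt_space V 2"
  using assms scale_left_distrib[of 1 1 "vmode V (h x) (- 1) (h y)"]
  by (simp add: wt_space_def L0_commutator L0_heis)

text \<open>Wick contraction in the two possible ways. With dual vectors for \<open>w\<close> and
  \<open>z\<close> it detects single coefficients in a combination of quadratic states.\<close>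

lemma quadratic_contraction:
  assumes "w \<in> carrier_vec n" "z \<in> carrier_vec n" "x \<in> carrier_vec n" "y \<in> carrier_vec n"
  shows "vmode V (h w) 1 (vmode V (h z) 1 (vmode V (h x) (- 1) (h y))) =
    scl V (lat_form Q z x * lat_form Q w y + lat_form Q z y * lat_form Q w x) (vac V)"
proof -
  have "vmode V (h z) 1 (vmode V (h x) (- 1) (h y)) =
      scl V (lat_form Q z x) (h y) + scl V (lat_form Q z y) (h x)"
    using heis_comm[of z x 1 "- 1" "h y"] assms
    by (simp add: heis_mode_heis mode_scale creation algebra_simps)
  then show ?thesis
    using assms by (simp add: mode_add mode_scale heis_mode_heis scale_left_distrib)
qed

end

section \<open>The character on the imaginary axis\<close>

text \<open>The point on the imaginary axis is parametrised so that q = 1/x; the cusp corresponds to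
  x tending to infinity.\<close>

lemma imaginary_axis_exponent:
  assumes "x > 0"
  shows "2 * of_real pi * \<i> * Complex 0 (ln x / (2 * pi)) = of_real (- ln x)"
proof -
  have "2 * of_real pi * \<i> * Complex 0 (ln x / (2 * pi)) = - of_real (2 * pi * (ln x / (2 * pi)))"
    unfolding Complex_eq by simp
  then show ?thesis by simp
qed

text \<open>The shift c/24 is 72/24 = 3, so weight \<open>n\<close> contributes q to the power
  \<open>n - 3\<close>, which is x to the power \<open>3 - n\<close>.\<close>

lemma character_imaginary_axis:
  assumes "central_charge V = 72" "x > 0"
  shows "voa_character V (Complex 0 (ln x / (2 * pi))) =
    infsum (\<lambda>n::int. of_real (real (Vector_Spaces.vector_space.dim (scl V) (wt_space V (of_int n)))
      * x powr (3 - real_of_int n))) UNIV"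
proof -
  have "exp (2 * of_real pi * \<i> * Complex 0 (ln x / (2 * pi)) * (of_int n - central_charge V / 24))
      = of_real (x powr (3 - real_of_int n))" for n
  proof -
    have "exp (2 * of_real pi * \<i> * Complex 0 (ln x / (2 * pi)) * (of_int n - central_charge V / 24))
      = exp (of_real (ln x * (3 - real_of_int n)))"
      unfolding imaginary_axis_exponent[OF assms(2)] assms(1) by (simp add: algebra_simps)
    also have "\<dots> = of_real (x powr (3 - real_of_int n))"
      using assms(2) by (simp only: exp_of_real powr_def) (simp add: mult.commute)
    finally show ?thesis .
  qed
  then show ?thesis by (simp add: voa_character_def)
qed

lemma qpar_imaginary_axis:
  assumes "x > 0"
  shows "qpar (Complex 0 (ln x / (2 * pi))) = of_real (inverse x)"
  using assms unfolding qpar_def imaginary_axis_exponent[OF assms] exp_of_real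
  by (simp add: exp_minus)

text \<open>
  On the imaginary axis all terms of the character are nonnegative, so that finitely many of them
  bound it from below.  Where the defining sum diverges, the character has the junk value 0, which
  contradicts the asymptotic expansion.
\<close>

lemma dim_weight_two_le:
  fixes V :: "'v::ab_group_add voa_data"
  defines "d \<equiv> \<lambda>n::int. Vector_Spaces.vector_space.dim (scl V) (wt_space V (of_int n))"
  assumes c: "central_charge V = 72" and d0: "d 0 \<ge> 1"
    and character:
      "(\<lambda>\<tau>. voa_character V \<tau> - (qpar \<tau> powi (-3) + of_nat N * qpar \<tau> powi (-1) + M))
        \<in> O[filtercomap Im at_top](qpar)"
  shows "d 2 \<le> N"
proof (rule ccontr)
  assume "\<not> d 2 \<le> N"
  then have d2: "real (d 2) \<ge> real N + 1" by linarith
  obtain C where C: "C > 0" "\<forall>\<^sub>F \<tau> in filtercomap Im at_top.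
      norm (voa_character V \<tau> - (qpar \<tau> powi (-3) + of_nat N * qpar \<tau> powi (-1) + M)) \<le> C * norm (qpar \<tau>)"
    by (rule landau_o.bigE[OF character]) simp
  then obtain t0 where t0: "\<And>\<tau>. Im \<tau> \<ge> t0 \<Longrightarrow>
      norm (voa_character V \<tau> - (qpar \<tau> powi (-3) + of_nat N * qpar \<tau> powi (-1) + M)) \<le> C * norm (qpar \<tau>)"
    by (auto simp: eventually_filtercomap_at_top_linorder)
  \<comment> \<open>The first bound places the point in the region where the estimate holds; the
    second makes one additional \<open>x\<close> in the character outweigh the error term together
    with the constant \<open>M\<close>.\<close>
  define x where "x = max (exp (2 * pi * t0)) (1 + C + norm M)"
  have x: "x > 1" "x > C + norm M" "x \<ge> exp (2 * pi * t0)"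
    using C(1) norm_ge_zero[of M] unfolding x_def by linarith+
  let ?\<tau> = "Complex 0 (ln x / (2 * pi))"
  have "ln x \<ge> 2 * pi * t0" using x by (simp add: ln_ge_iff)
  then have "Im ?\<tau> \<ge> t0" by (simp add: field_simps)
  moreover have q: "qpar ?\<tau> = of_real (inverse x)" using x by (simp add: qpar_imaginary_axis)
  moreover have "(of_real (inverse x) :: complex) powi (-3) = of_real (x ^ 3)"
    "(of_real (inverse x) :: complex) powi (-1) = of_real x"
    by (simp_all add: power_int_minus power_int_def)
  ultimately have "norm (voa_character V ?\<tau> - (of_real (x ^ 3) + of_nat N * of_real x + M))
      \<le> C * inverse x"
    using t0[of ?\<tau>] x by (simp add: norm_inverse)
  also have "\<dots> \<le> C" using x C(1) by (simp add: field_simps)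
  finally have bound: "norm (voa_character V ?\<tau> - of_real (x ^ 3 + N * x)) \<le> C + norm M"
    using norm_triangle_ineq[of "voa_character V ?\<tau> - (of_real (x ^ 3) + of_nat N * of_real x + M)" M]
    by (simp add: algebra_simps)
  define a where "a n = real (d n) * x powr (3 - real_of_int n)" for n
  have \<chi>: "voa_character V ?\<tau> = infsum (\<lambda>n. of_real (a n)) UNIV"
    using character_imaginary_axis[OF c, of x] x by (simp add: a_def d_def)
  have "x ^ 3 \<ge> x" using x power_increasing[of 1 3 x] by simp
  show False
  proof (cases "a summable_on UNIV")
    case True
    then have "voa_character V ?\<tau> = of_real (infsum a UNIV)"
      unfolding \<chi> by (intro infsumI has_sum_of_real) (simp add: has_sum_infsum)
    then have "voa_character V ?\<tau> - of_real (x ^ 3 + N * x) = of_real (infsum a UNIV - (x ^ 3 + N * x))"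
      by simp
    then have *: "infsum a UNIV \<le> x ^ 3 + N * x + C + norm M"
      using bound by (simp only: norm_of_real)
    \<comment> \<open>Weight 0 supplies at least \<open>x ^ 3\<close> and weight 2 at least
      \<open>(N + 1) * x\<close>, exceeding the upper bound by more than the available
      slack.\<close>
    have "sum a {0, 2} \<le> infsum a UNIV"
      by (rule finite_sum_le_infsum[OF True]) (use x in \<open>auto simp: a_def\<close>)
    moreover have "x powr 3 = x ^ 3" "x powr 1 = x" using x by (simp_all add: powr_numeral)
    then have "sum a {0, 2} = d 0 * x ^ 3 + d 2 * x" by (simp add: a_def)
    moreover have "d 0 * x ^ 3 \<ge> 1 * x ^ 3" by (rule mult_right_mono) (use d0 x in auto)
    moreover have "d 2 * x \<ge> (real N + 1) * x" by (rule mult_right_mono) (use d2 x in auto)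
    moreover have "(real N + 1) * x = real N * x + x" by (simp add: algebra_simps)
    ultimately show False using * x by linarith
  next
    case False
    \<comment> \<open>Taking real parts carries divergence over to the complex series. The value 0
      then forces \<open>x ^ 3 + N * x\<close> below \<open>C + norm M\<close>, although
      \<open>x ^ 3 \<ge> x\<close> is already larger.\<close>
    have "\<not> (\<lambda>n. of_real (a n) :: complex) summable_on UNIV"
    proof
      assume "(\<lambda>n. of_real (a n) :: complex) summable_on UNIV"
      from summable_on_Re[OF this] False show False by simp
    qed
    then have "voa_character V ?\<tau> = 0" unfolding \<chi> by (rule infsum_not_exists)
    then have "\<bar>x ^ 3 + N * x\<bar> \<le> C + norm M" using bound by (simp only: diff_0 norm_minus_cancel norm_of_real)
    moreover have "real N * x \<ge> 0" using x by simp
    ultimately show False using x \<open>x ^ 3 \<ge> x\<close> by linarith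
  qed
qed

section \<open>Invariant quadratic states in orbifolds\<close>

text \<open>Mode 1 of the unit vectors recovers the coordinates of \<open>Qc *\<^sub>v x\<close>
  from \<open>h x\<close>, and \<open>Qc\<close> is invertible.\<close>

lemma (in heisenberg_voa) h_inj:
  assumes "x \<in> carrier_vec n" "y \<in> carrier_vec n" "h x = h y"
  shows "x = y"
proof -
  have form: "lat_form Q (unit_vec n i) z = (Qc *\<^sub>v z) $ i" if "i < n" "z \<in> carrier_vec n" for i z
    using that Qc by (auto simp: lat_form_def)
  have "Qc *\<^sub>v x = Qc *\<^sub>v y"
  proof (rule eq_vecI)
    fix i assume "i < dim_vec (Qc *\<^sub>v y)"
    then have i: "i < n" using Q by simp
    have "scl V (lat_form Q (unit_vec n i) x) (vac V) = scl V (lat_form Q (unit_vec n i) y) (vac V)"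
      using heis_mode_heis[of "unit_vec n i" x 1] heis_mode_heis[of "unit_vec n i" y 1] assms by auto
    then show "(Qc *\<^sub>v x) $ i = (Qc *\<^sub>v y) $ i"
      unfolding form[OF i assms(1)] form[OF i assms(2)]
      using vac_nonzero by (rule scale_right_imp_eq[rotated])
  qed simp
  then have "Pc *\<^sub>v (Qc *\<^sub>v x) = Pc *\<^sub>v (Qc *\<^sub>v y)" by simp
  then show ?thesis
    using Pc Qc assms by (simp add: assoc_mult_mat_vec[of _ n n _ n, symmetric] PcQc)
qed

text \<open>Transfers finite order from the lift to the isometry, as diagonalisation requires:
  iterates of \<open>f\<close> act on the states \<open>h x\<close> through powers of
  \<open>g\<close>, and \<open>h\<close> is injective.\<close>

lemma (in heisenberg_voa) isometry_pow_eq_one: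
  fixes g :: "complex mat"
  assumes g: "g \<in> carrier_mat n n" and fh: "\<And>x. x \<in> carrier_vec n \<Longrightarrow> f (h x) = h (g *\<^sub>v x)"
    and pow: "f ^^ m = id"
  shows "g ^\<^sub>m m = 1\<^sub>m n"
proof -
  have gk: "g ^\<^sub>m k \<in> carrier_mat n n" for k using g by simp
  have iter: "(f ^^ k) (h x) = h (g ^\<^sub>m k *\<^sub>v x)" if "x \<in> carrier_vec n" for k x
    using that
  proof (induction k arbitrary: x)
    case 0
    then show ?case using g by simp
  next
    case (Suc k)
    have gx: "g *\<^sub>v x \<in> carrier_vec n" using g Suc.prems by (rule mult_mat_vec_carrier)
    have "(f ^^ Suc k) (h x) = (f ^^ k) (f (h x))" by (simp only: funpow_Suc_right o_apply)
    also have "\<dots> = h (g ^\<^sub>m k *\<^sub>v (g *\<^sub>v x))"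
      unfolding fh[OF Suc.prems] by (rule Suc.IH[OF gx])
    also have "g ^\<^sub>m k *\<^sub>v (g *\<^sub>v x) = g ^\<^sub>m Suc k *\<^sub>v x"
      using assoc_mult_mat_vec[OF gk g Suc.prems] by simp
    finally show ?case .
  qed
  have fix_all: "g ^\<^sub>m m *\<^sub>v x = x" if x: "x \<in> carrier_vec n" for x
    using iter[OF x, of m] h_inj[OF mult_mat_vec_carrier[OF gk x] x] by (simp add: pow)
  show ?thesis
  proof (rule eq_matI)
    fix i j assume "i < dim_row (1\<^sub>m n :: complex mat)" "j < dim_col (1\<^sub>m n :: complex mat)"
    then have ij: "i < n" "j < n" by auto
    have "(g ^\<^sub>m m *\<^sub>v unit_vec n j) $ i = unit_vec n j $ i"
      using fix_all[of "unit_vec n j"] by simp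
    moreover have "(g ^\<^sub>m m *\<^sub>v unit_vec n j) $ i = (g ^\<^sub>m m) $$ (i, j)"
      using ij carrier_matD[OF gk[of m]] by simp
    ultimately show "(g ^\<^sub>m m) $$ (i, j) = 1\<^sub>m n $$ (i, j)" using ij by simp
  qed (use carrier_matD[OF gk[of m]] in auto)
qed

lemma (in heisenberg_voa) quadratic_invariants:
  assumes g: "lat_aut n Q g" and f: "voa_aut V f"
    and fh: "\<And>x. x \<in> carrier_vec n \<Longrightarrow> f (h x) = h (map_mat of_int g *\<^sub>v x)"
    and pow: "f ^^ m = id" and m: "m > 0"
  obtains T :: "(nat \<times> nat) set" and u :: "nat \<times> nat \<Rightarrow> 'v"
  where "finite T" "n \<le> 2 * card T" "u ` T \<subseteq> fixed_points {f ^^ i | i. True} \<inter> wt_space V 2"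
    "\<And>c. (\<Sum>t\<in>T. scl V (c t) (u t)) = 0 \<Longrightarrow> \<forall>t\<in>T. c t = 0"
proof -
  let ?g = "map_mat of_int g :: complex mat"
  have g': "g \<in> carrier_mat n n" "transpose_mat g * Q * g = Q" using g by (auto simp: lat_aut_def)
  have gc: "?g \<in> carrier_mat n n" using g' by simp
  have gtQ: "transpose_mat g * Q \<in> carrier_mat n n" using g'(1) Q by simp
  have "map_mat of_int (transpose_mat g * Q * g) = (map_mat of_int (transpose_mat g) * Qc * ?g)"
    unfolding of_int_hom.mat_hom_mult[OF gtQ g'(1)]
      of_int_hom.mat_hom_mult[OF transpose_carrier_mat[THEN iffD2, OF g'(1)] Q] ..
  then have iso: "transpose_mat ?g * Qc * ?g = Qc" by (simp add: g' map_mat_transpose)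
  obtain v w :: "nat \<Rightarrow> complex vec" and l p where
    v: "\<And>i. i < n \<Longrightarrow> v i \<in> carrier_vec n" and w: "\<And>i. i < n \<Longrightarrow> w i \<in> carrier_vec n"
    and eigen: "\<And>i. i < n \<Longrightarrow> ?g *\<^sub>v v i = l i \<cdot>\<^sub>v v i"
    and dual: "\<And>i j. i < n \<Longrightarrow> j < n \<Longrightarrow> w i \<bullet> (Qc *\<^sub>v v j) = (if i = j then 1 else 0)"
    and p: "\<And>i. i < n \<Longrightarrow> p i < n" and lp: "\<And>i. i < n \<Longrightarrow> l i * l (p i) = 1"
    by (rule isometry_eigenbasis[OF gc Qc Pc QcPc iso isometry_pow_eq_one[OF gc fh pow] m]) blast+
  \<comment> \<open>Sorting the two indices encodes the unordered pair of \<open>i\<close> and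
    \<open>p i\<close>, so that the two orders of a product are counted once.\<close>
  define T where "T = (\<lambda>i. (min i (p i), max i (p i))) ` {..<n}"
  define u where "u t = vmode V (h (v (fst t))) (- 1) (h (v (snd t)))" for t
  have T: "fst t \<le> snd t" "fst t < n" "snd t < n" "l (fst t) * l (snd t) = 1" if "t \<in> T" for t
    using that p lp by (auto simp: T_def min_def max_def mult.commute)
  have fin: "finite T" by (simp add: T_def)
  \<comment> \<open>Every index lies in some pair and a pair has at most two entries, whence
    \<open>n \<le> 2 * card T\<close>.\<close>
  have "{..<n} \<subseteq> fst ` T \<union> snd ` T"
    by (force simp: T_def image_image min_def max_def)
  then have "card {..<n} \<le> card (fst ` T \<union> snd ` T)" using fin by (intro card_mono) auto
  also have "\<dots> \<le> card (fst ` T) + card (snd ` T)" by (rule card_Un_le)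
  also have "\<dots> \<le> card T + card T" using fin by (intro add_mono card_image_le)
  finally have card: "n \<le> 2 * card T" by simp
  have "u t \<in> fixed_points {f ^^ i | i. True} \<inter> wt_space V 2" if t: "t \<in> T" for t
  proof
    have fv: "f (h (v i)) = scl V (l i) (h (v i))" if "i < n" for i
      using that v eigen by (simp add: fh h_scale)
    have "f (u t) = vmode V (f (h (v (fst t)))) (- 1) (f (h (v (snd t))))"
      using f by (simp add: u_def voa_aut_def)
    also have "\<dots> = scl V (l (fst t) * l (snd t)) (u t)"
      using T[OF t] by (simp add: fv u_def mode_scale mode_scale_left mult.commute)
    finally have fu: "f (u t) = u t" using T[OF t] by simp
    have "(f ^^ i) (u t) = u t" for i by (induction i) (simp_all add: fu)
    then show "u t \<in> fixed_points {f ^^ i | i. True}" by (auto simp: fixed_points_def)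
    show "u t \<in> wt_space V 2" unfolding u_def using T[OF t] v by (intro quadratic_weight_two)
  qed
  moreover have "\<forall>t\<in>T. c t = 0" if c0: "(\<Sum>t\<in>T. scl V (c t) (u t)) = 0" for c
  proof
    fix s assume s: "s \<in> T"
    \<comment> \<open>Contraction with the dual vectors of the pair \<open>s\<close>. As pairs are
      sorted, the crossed contraction is nonzero only for \<open>t = s\<close> with equal entries;
      it then doubles the value, which \<open>r\<close> records.\<close>
    let ?\<phi> = "\<lambda>y. vmode V (h (w (fst s))) 1 (vmode V (h (w (snd s))) 1 y)"
    define r where "r = (if fst s = snd s then 2 else 1 :: complex)"
    have \<phi>: "?\<phi> (u t) = scl V (if t = s then r else 0) (vac V)" if "t \<in> T" for t
      using T[OF that] T[OF s] v w dual
      by (cases s; cases t) (auto simp: u_def quadratic_contraction lat_form_def r_def)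
    have "0 = ?\<phi> (\<Sum>t\<in>T. scl V (c t) (u t))" by (simp add: c0)
    also have "\<dots> = (\<Sum>t\<in>T. scl V (c t) (?\<phi> (u t)))" by (simp add: mode_sum mode_scale)
    also have "\<dots> = (\<Sum>t\<in>T. if t = s then scl V (c s * r) (vac V) else 0)"
      by (rule sum.cong) (simp_all add: \<phi>)
    also have "\<dots> = scl V (c s * r) (vac V)" using fin s by simp
    finally show "c s = 0" using vac_nonzero by (auto simp: r_def split: if_splits)
  qed
  ultimately show ?thesis using that[of T u] fin card by blast
qed

section \<open>From lattice VOAs to their orbifolds: central charge and dimensions\<close>

lemma heisenberg_of_lattice_voa:
  assumes "lattice_voa n Q \<epsilon> V h e"
  obtains P where "heisenberg_voa V n Q P h"
proof -
  obtain P where P: "P \<in> carrier_mat n n" "Q * P = 1\<^sub>m n"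
    "conf V = scl V (1 / 2) (\<Sum>i<n. \<Sum>j<n. scl V (of_int (P $$ (i, j)))
        (vmode V (h (unit_vec n i)) (- 1) (h (unit_vec n j))))"
    using assms unfolding lattice_voa_def by (elim conjE bexE) (rule that)
  have "heisenberg_voa V n Q P h"
    by unfold_locales (use assms P in \<open>simp_all add: lattice_voa_def even_unimodular_def\<close>)
  then show ?thesis by (rule that)
qed

text \<open>Extracts the untwisted sector, the summand of the identity class. Its weight spaces
  embed into those of \<open>V\<close> and so bound their dimensions from below.\<close>

lemma orbifold_embedding:
  assumes "is_orbifold V0 K V"
  obtains \<iota> where "voa V0" "voa V" "\<And>k. k \<in> K \<Longrightarrow> voa_aut V0 k"
    "lin_on (scl V0) (scl V) (fixed_points K) \<iota>" "inj_on \<iota> (fixed_points K)"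
    "\<iota> (vac V0) = vac V" "\<iota> (conf V0) = conf V"
    "\<And>a b i. a \<in> fixed_points K \<Longrightarrow> b \<in> fixed_points K \<Longrightarrow>
      \<iota> (vmode V0 a i b) = vmode V (\<iota> a) i (\<iota> b)"
proof -
  have V: "voa V0" "voa V" and sub: "subgroup K (voa_aut_group V0)"
    using assms by (simp_all add: is_orbifold_def holomorphic_voa_def)
  have aut: "voa_aut V0 k" if "k \<in> K" for k
    using subgroup.subset[OF sub] that by (auto simp: voa_aut_group_def)
  obtain \<iota> where "lin_on (scl V0) (scl V) (fixed_points K) \<iota>" "inj_on \<iota> (fixed_points K)"
    "\<iota> (vac V0) = vac V" "\<iota> (conf V0) = conf V"
    "\<forall>a\<in>fixed_points K. \<forall>b\<in>fixed_points K. \<forall>i.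
        \<iota> (vmode V0 a i b) = vmode V (\<iota> a) i (\<iota> b)"
    using assms unfolding is_orbifold_def by (elim conjE exE) (rule that)
  then show ?thesis using that[OF V aut] by blast
qed

text \<open>Both central charges are read off from mode 3 of the conformal vector on itself, which
  \<open>\<iota>\<close> preserves.\<close>

lemma orbifold_central_charge:
  assumes "is_orbifold V0 K V"
  shows "central_charge V0 = central_charge V"
proof -
  obtain \<iota> where V0: "voa V0" and V: "voa V" and aut: "\<And>k. k \<in> K \<Longrightarrow> voa_aut V0 k"
    and lin: "lin_on (scl V0) (scl V) (fixed_points K) \<iota>"
    and vac: "\<iota> (vac V0) = vac V" and conf: "\<iota> (conf V0) = conf V"
    and mode: "\<And>a b i. a \<in> fixed_points K \<Longrightarrow> b \<in> fixed_points K \<Longrightarrow>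
      \<iota> (vmode V0 a i b) = vmode V (\<iota> a) i (\<iota> b)"
    by (rule orbifold_embedding[OF assms]) blast
  interpret V0: vertex_operator_algebra V0 by (unfold_locales) (rule V0)
  interpret V: vertex_operator_algebra V by (unfold_locales) (rule V)
  have fixed: "vac V0 \<in> fixed_points K" "conf V0 \<in> fixed_points K"
    using aut by (auto simp: fixed_points_def voa_aut_def)
  have "scl V (central_charge V0 / 2) (vac V) = \<iota> (scl V0 (central_charge V0 / 2) (vac V0))"
    using lin fixed by (simp add: lin_on_def vac)
  also have "\<dots> = vmode V (conf V) 3 (conf V)"
    using mode[OF fixed(2) fixed(2), of 3] by (simp add: V0.conf_mode_3_conf conf)
  finally show ?thesis
    using V.vac_nonzero by (simp add: V.conf_mode_3_conf)
qed

text \<open>The embedding \<open>\<iota>\<close> preserves independence by injectivity and weights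
  because it matches the conformal vectors. As it is linear on fixed points only, closure of these
  under linear combinations comes first.\<close>

lemma orbifold_card_le_dim:
  assumes orb: "is_orbifold V0 K V" and T: "finite T"
    and u: "u ` T \<subseteq> fixed_points K \<inter> wt_space V0 (of_int k)"
    and indep: "\<And>c. (\<Sum>t\<in>T. scl V0 (c t) (u t)) = 0 \<Longrightarrow> \<forall>t\<in>T. c t = 0"
  shows "card T \<le> Vector_Spaces.vector_space.dim (scl V) (wt_space V (of_int k))"
proof -
  obtain \<iota> where V0: "voa V0" and V: "voa V" and aut: "\<And>k. k \<in> K \<Longrightarrow> voa_aut V0 k"
    and lin: "lin_on (scl V0) (scl V) (fixed_points K) \<iota>" and inj: "inj_on \<iota> (fixed_points K)"
    and conf: "\<iota> (conf V0) = conf V"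
    and mode: "\<And>a b i. a \<in> fixed_points K \<Longrightarrow> b \<in> fixed_points K \<Longrightarrow>
      \<iota> (vmode V0 a i b) = vmode V (\<iota> a) i (\<iota> b)"
    by (rule orbifold_embedding[OF orb]) blast
  interpret V0: vertex_operator_algebra V0 by (unfold_locales) (rule V0)
  interpret V: vertex_operator_algebra V by (unfold_locales) (rule V)
  let ?F = "fixed_points K"
  have klin: "k (x + y) = k x + k y" "k (scl V0 c x) = scl V0 c (k x)" if "k \<in> K" for k x y c
    using aut[OF that] by (simp_all add: voa_aut_def lin_on_def)
  have kfix: "k x = x" if "k \<in> K" "x \<in> ?F" for k x
    using that by (auto simp: fixed_points_def)
  have add: "x + y \<in> ?F" "\<iota> (x + y) = \<iota> x + \<iota> y" if "x \<in> ?F" "y \<in> ?F" for x y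
  proof -
    have "k (x + y) = x + y" if "k \<in> K" for k
      using klin(1)[OF that, of x y] kfix[OF that] \<open>x \<in> ?F\<close> \<open>y \<in> ?F\<close> by simp
    then show "x + y \<in> ?F" by (simp add: fixed_points_def)
    show "\<iota> (x + y) = \<iota> x + \<iota> y" using that lin by (simp add: lin_on_def)
  qed
  have scale: "scl V0 c x \<in> ?F" "\<iota> (scl V0 c x) = scl V c (\<iota> x)" if "x \<in> ?F" for c x
  proof -
    have "k (scl V0 c x) = scl V0 c x" if "k \<in> K" for k
      using klin(2)[OF that, of c x] kfix[OF that \<open>x \<in> ?F\<close>] by simp
    then show "scl V0 c x \<in> ?F" by (simp add: fixed_points_def)
    show "\<iota> (scl V0 c x) = scl V c (\<iota> x)" using that lin by (simp add: lin_on_def)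
  qed
  have conf_fix: "conf V0 \<in> ?F" using aut by (auto simp: fixed_points_def voa_aut_def)
  have zero: "0 \<in> ?F" "\<iota> 0 = 0" using scale[OF conf_fix, of 0] by simp_all
  have uF: "u t \<in> ?F" "u t \<in> wt_space V0 (of_int k)" if "t \<in> T" for t using u that by auto
  have sum: "(\<Sum>t\<in>S. scl V0 (c t) (u t)) \<in> ?F \<and>
      \<iota> (\<Sum>t\<in>S. scl V0 (c t) (u t)) = (\<Sum>t\<in>S. scl V (c t) (\<iota> (u t)))" if "S \<subseteq> T" for S c
    using finite_subset[OF that T] that
    by (induction S rule: finite_induct) (simp_all add: zero add scale uF)
  \<comment> \<open>A relation among the images is \<open>\<iota>\<close> of a fixed vector;
    injectivity and \<open>\<iota> 0 = 0\<close> pull it back to a relation in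
    \<open>V0\<close>.\<close>
  have ind: "\<forall>t\<in>T. c t = 0" if "(\<Sum>t\<in>T. scl V (c t) (\<iota> (u t))) = 0" for c
  proof (rule indep, rule inj_onD[OF inj _ _ zero(1)])
    show "\<iota> (\<Sum>t\<in>T. scl V0 (c t) (u t)) = \<iota> 0" "(\<Sum>t\<in>T. scl V0 (c t) (u t)) \<in> ?F"
      using that sum[of T c] zero by simp_all
  qed
  have sub: "(\<lambda>t. \<iota> (u t)) ` T \<subseteq> wt_space V (of_int k)"
  proof clarify
    fix t assume t: "t \<in> T"
    have "\<iota> (vmode V0 (conf V0) 1 (u t)) = scl V (of_int k) (\<iota> (u t))"
      using uF[OF t] by (simp add: wt_space_def vir_def scale)
    then show "\<iota> (u t) \<in> wt_space V (of_int k)"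
      using mode[OF conf_fix uF(1)[OF t], of 1] by (simp add: wt_space_def vir_def conf)
  qed
  obtain B where B: "finite B" "wt_space V (of_int k) \<subseteq> V.span B"
    using V.fin_dim_wt_space[of k] unfolding fin_dim_def by blast
  show ?thesis
    by (rule V.card_le_dimI[where u = "\<lambda>t. \<iota> (u t)", OF T _ sub B]) (rule ind)
qed

section \<open>The contradiction in weight two\<close>

theorem corollary8p2:
  fixes Q :: "int mat"
    and \<epsilon> :: "int vec \<Rightarrow> int vec \<Rightarrow> complex"
    and V\<Gamma> :: "'u::ab_group_add voa_data"
    and h :: "complex vec \<Rightarrow> 'u" and e :: "int vec \<Rightarrow> 'u"
    and G :: "int mat set" and \<rho> :: "nat \<times> nat \<Rightarrow> int mat"
    and G' :: "('u \<Rightarrow> 'u) set" and \<sigma> :: "int mat \<Rightarrow> 'u \<Rightarrow> 'u"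
    and V :: "'v::ab_group_add voa_data"
  assumes \<Gamma>: "nebe_lattice Q"
    and V\<Gamma>: "lattice_voa 72 Q \<epsilon> V\<Gamma> h e"
    and G: "subgroup G (lat_aut_group 72 Q)"
      "\<rho> \<in> iso Z7_Z78 (lat_aut_group 72 Q\<lparr>carrier := G\<rparr>)"
      "has_cycle_type (\<rho> (1, 0)) [(1, -12), (7, 12)]"
      "has_cycle_type (\<rho> (0, 1)) [(3, 2), (6, -2), (39, -2), (78, 2)]"
    and G': "subgroup G' (voa_aut_group V\<Gamma>)"
      "\<sigma> \<in> iso (lat_aut_group 72 Q\<lparr>carrier := G\<rparr>) (voa_aut_group V\<Gamma>\<lparr>carrier := G'\<rparr>)"
      "\<forall>g\<in>G. is_standard_lift 72 V\<Gamma> h e g (\<sigma> g)"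
    and orbifold: "is_orbifold V\<Gamma> G' V"
    and central_charge: "central_charge V = 72"
    and character:
      "(\<lambda>\<tau>. voa_character V \<tau> - (qpar \<tau> powi (-3) + 12 * qpar \<tau> powi (-1) + 200))
        \<in> O[filtercomap Im at_top](qpar)"
  shows "\<not> (\<exists>n P \<delta> (VL :: 'l::ab_group_add voa_data) h' e' g f.
      even_unimodular n P \<and> lattice_voa n P \<delta> VL h' e' \<and>
      lat_aut n P g \<and> is_lift n VL h' e' g f \<and> (\<exists>m>0. f ^^ m = id) \<and>
      is_orbifold VL {f ^^ i | i. True} V)"
proof
  assume "\<exists>n P \<delta> (VL :: 'l::ab_group_add voa_data) h' e' g f.
      even_unimodular n P \<and> lattice_voa n P \<delta> VL h' e' \<and>
      lat_aut n P g \<and> is_lift n VL h' e' g f \<and> (\<exists>m>0. f ^^ m = id) \<and>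
      is_orbifold VL {f ^^ i | i. True} V"
  then obtain n P \<delta> h' e' g f m and VL :: "'l voa_data" where
    VL: "lattice_voa n P \<delta> VL h' e'" and g: "lat_aut n P g" and f: "is_lift n VL h' e' g f"
    and m: "m > 0" "f ^^ m = id" and orb: "is_orbifold VL {f ^^ i | i. True} V"
    by (elim exE conjE) (rule that)
  obtain R where "heisenberg_voa VL n P R h'"
    by (rule heisenberg_of_lattice_voa[OF VL])
  then interpret VL: heisenberg_voa VL n P R h' .
  have aut: "voa_aut VL f"
    and fh: "\<And>x. x \<in> carrier_vec n \<Longrightarrow> f (h' x) = h' (map_mat of_int g *\<^sub>v x)"
    using f by (auto simp: is_lift_def lift_with_def)
  obtain T :: "(nat \<times> nat) set" and u where T: "finite T" "n \<le> 2 * card T"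
    and u: "u ` T \<subseteq> fixed_points {f ^^ i | i. True} \<inter> wt_space VL 2"
    and indep: "\<And>c. (\<Sum>t\<in>T. scl VL (c t) (u t)) = 0 \<Longrightarrow> \<forall>t\<in>T. c t = 0"
    by (rule VL.quadratic_invariants[OF g aut fh m(2,1)]) ((rule that | assumption)+)
  \<comment> \<open>The rank of the competing lattice is its central charge, which the orbifold
    inherits. Rank 72 gives at least 36 pairs.\<close>
  have "of_nat n = (72 :: complex)"
    using orbifold_central_charge[OF orb] central_charge VL by (simp add: lattice_voa_def)
  then have "n = 72" using of_nat_eq_iff[of n 72, where 'a = complex] by simp
  then have "36 \<le> card T" using T by simp
  also have "card T \<le> Vector_Spaces.vector_space.dim (scl V) (wt_space V (of_int 2))"
    by (rule orbifold_card_le_dim[OF orb T(1) _ indep]) (use u in simp)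
  also have "\<dots> \<le> 12"
  \<comment> \<open>Weight 2 corresponds to q to the power 2 - 3 = -1, whose coefficient in the
    character is 12; the constant 200 takes the place of \<open>M\<close>.\<close>
  proof (rule dim_weight_two_le[OF central_charge])
    have "voa V" using orb by (simp add: is_orbifold_def holomorphic_voa_def)
    then interpret V: vertex_operator_algebra V by unfold_locales
    show "1 \<le> V.dim (wt_space V (of_int 0))" by (rule V.one_le_dim_wt_space_0)
    show "(\<lambda>\<tau>. voa_character V \<tau> - (qpar \<tau> powi (-3) + of_nat 12 * qpar \<tau> powi (-1) + 200))
        \<in> O[filtercomap Im at_top](qpar)"
      using character by simp
  qed
  finally show False by simp
qed

end
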